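(* Let $s, t \geq 2$ be integers, let $G$ be a $\mathcal{J}_{s,t}$-minor-free graph, and let $(T, \mathcal{W})$ be a tree-decomposition of $G$. Then $G$ has a partition of $\mathcal{W}$-width at most $t-1$ and treewidth at most $s$.
   Context: All graphs are finite, simple and undirected. $\mathcal{J}_{s,t}$ is the class of graphs whose vertex-set has a partition $A \cup B$ with $|A| = s$, $|B| = t$, $A$ a clique, every vertex of $A$ adjacent to every vertex of $B$, and $G[B]$ connected. A graph is $\mathcal{J}_{s,t}$-minor-free if it contains no graph of $\mathcal{J}_{s,t}$ as a minor. A tree-decomposition $(T,\mathcal{W})$, $\mathcal{W} = (W_x : x \in V(T))$, consists of a tree $T$ and bags $W_x \subseteq V(G)$ such that for each vertex $v$ the nodes whose bags contain $v$ induce a non-empty connected subtree of $T$, and each edge has both ends in some bag. A partition of $G$ is a graph $H$ whose vertices (called parts) are sets of vertices of $G$, such that each vertex of $G$ lies in exactly one part, and for every edge $vw$ of $G$ with $v \in X \in V(H)$, $w \in Y \in V(H)$, either $X = Y$ or $XY \in E(H)$. The treewidth of a partition $H$ is $\mathrm{tw}(H)$. The $\mathcal{W}$-width of a set $S \subseteq V(G)$ is the minimum number of bags of $\mathcal{W}$ whose union contains $S$; the $\mathcal{W}$-width of a partition $H$ is the maximum $\mathcal{W}$-width of a part of $H$. *)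

theory Defs
  imports
    "Graph_Theory.Digraph_Component"
    "Graph_Theory.Digraph_Isomorphism"
begin

text \<open>
  A finite simple undirected graph is a \<^typ>\<open>'a pair_pre_digraph\<close> satisfying \<^const>\<open>pair_graph\<close>:
  finite, loop-free, and with a symmetric set of arcs, so that an edge \<open>uv\<close> is the
  pair of arcs \<open>(u,v)\<close>, \<open>(v,u)\<close>.  The null graph is a graph, but is not \<^const>\<open>connected\<close>.
\<close>

subsection \<open>Minors\<close>

text \<open>The edge \<open>uv\<close> is contracted onto \<open>u\<close>; the resulting loops and parallel edges vanish.\<close>

definition contract_edge :: "'a pair_pre_digraph \<Rightarrow> 'a \<Rightarrow> 'a \<Rightarrow> 'a pair_pre_digraph" where
  "contract_edge G u v =
     \<lparr> pverts = pverts G - {v},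
       parcs = map_prod (id(v := u)) (id(v := u)) ` parcs G - Id \<rparr>"

definition edge_contraction :: "'a pair_pre_digraph \<Rightarrow> 'a pair_pre_digraph \<Rightarrow> bool" where
  "edge_contraction G G' \<longleftrightarrow> (\<exists>u v. (u, v) \<in> parcs G \<and> G' = contract_edge G u v)"

definition minor :: "'b pair_pre_digraph \<Rightarrow> 'a pair_pre_digraph \<Rightarrow> bool" where
  "minor H G \<longleftrightarrow>
     (\<exists>G0 G1. pair_graph G0 \<and> subgraph (with_proj G0) (with_proj G) \<and>
        edge_contraction\<^sup>*\<^sup>* G0 G1 \<and> digraph_iso (with_proj G1) (with_proj H))"

definition J_class :: "nat \<Rightarrow> nat \<Rightarrow> 'a pair_pre_digraph set" where
  "J_class s t =
     {H. pair_graph H \<and>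
        (\<exists>A B. A \<union> B = pverts H \<and> A \<inter> B = {} \<and> card A = s \<and> card B = t \<and>
           (\<forall>u\<in>A. \<forall>v\<in>A. u \<noteq> v \<longrightarrow> (u, v) \<in> parcs H) \<and>
           (\<forall>a\<in>A. \<forall>b\<in>B. (a, b) \<in> parcs H) \<and>
           connected (with_proj H \<restriction> B))}"

text \<open>
  Every finite graph is isomorphic to one on natural numbers and \<^const>\<open>minor\<close> is
  invariant under isomorphism, so it suffices to let \<open>H\<close> range over the latter.
\<close>

definition J_minor_free :: "nat \<Rightarrow> nat \<Rightarrow> 'a pair_pre_digraph \<Rightarrow> bool" where
  "J_minor_free s t G \<longleftrightarrow> (\<forall>H :: nat pair_pre_digraph. H \<in> J_class s t \<longrightarrow> \<not> minor H G)"


subsection \<open>Tree-decompositions and treewidth\<close>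

text \<open>
  The library's \<^const>\<open>tree\<close> is not usable here: in a symmetric digraph every edge yields a
  directed cycle of length 2.  Cycles of the undirected graph are those of length at least 3.
\<close>

definition graph_tree :: "'b pair_pre_digraph \<Rightarrow> bool" where
  "graph_tree T \<longleftrightarrow>
     pair_graph T \<and> connected (with_proj T) \<and>
     \<not> (\<exists>p. pre_digraph.cycle (with_proj T) p \<and> 3 \<le> length p)"

definition tree_decomposition ::
  "'a pair_pre_digraph \<Rightarrow> 'b pair_pre_digraph \<Rightarrow> ('b \<Rightarrow> 'a set) \<Rightarrow> bool" where
  "tree_decomposition G T W \<longleftrightarrow>
     graph_tree T \<and>
     (\<forall>x\<in>pverts T. W x \<subseteq> pverts G) \<and>
     (\<forall>v\<in>pverts G. connected (with_proj T \<restriction> {x \<in> pverts T. v \<in> W x})) \<and>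
     (\<forall>(u, v)\<in>parcs G. \<exists>x\<in>pverts T. u \<in> W x \<and> v \<in> W x)"

definition decomposition_width :: "'b pair_pre_digraph \<Rightarrow> ('b \<Rightarrow> 'a set) \<Rightarrow> nat" where
  "decomposition_width T W = Max ((\<lambda>x. card (W x)) ` pverts T) - 1"

text \<open>
  Decomposition trees are finite, so taking their nodes to be natural numbers loses nothing.
  The null graph gets treewidth 0.
\<close>

definition treewidth :: "'a pair_pre_digraph \<Rightarrow> nat" where
  "treewidth G =
     (LEAST k. \<exists>(T :: nat pair_pre_digraph) W.
        tree_decomposition G T W \<and> decomposition_width T W = k)"


subsection \<open>Partitions\<close>

definition graph_partition :: "'a pair_pre_digraph \<Rightarrow> 'a set pair_pre_digraph \<Rightarrow> bool" where
  "graph_partition G H \<longleftrightarrow>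
     pair_graph H \<and>
     (\<forall>X\<in>pverts H. X \<subseteq> pverts G) \<and>
     (\<forall>v\<in>pverts G. \<exists>!X. X \<in> pverts H \<and> v \<in> X) \<and>
     (\<forall>(v, w)\<in>parcs G. \<forall>X\<in>pverts H. \<forall>Y\<in>pverts H.
        v \<in> X \<and> w \<in> Y \<longrightarrow> X = Y \<or> (X, Y) \<in> parcs H)"

definition set_bag_width :: "'b pair_pre_digraph \<Rightarrow> ('b \<Rightarrow> 'a set) \<Rightarrow> 'a set \<Rightarrow> nat" where
  "set_bag_width T W S = (LEAST n. \<exists>N \<subseteq> pverts T. card N = n \<and> S \<subseteq> (\<Union>x\<in>N. W x))"

text \<open>The \<open>0\<close> only matters for a partition without parts, whose width is thereby 0.\<close>

definition partition_bag_width ::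
  "'b pair_pre_digraph \<Rightarrow> ('b \<Rightarrow> 'a set) \<Rightarrow> 'a set pair_pre_digraph \<Rightarrow> nat" where
  "partition_bag_width T W H = Max (insert 0 (set_bag_width T W ` pverts H))"

end

theory Submission
  imports Defs "HOL-Library.Disjoint_Sets"
begin

text \<open>
  Parts are created one at a time, each inside a component \<open>C\<close> of the graph induced by the vertices
  not yet covered.  The parts with neighbours in \<open>C\<close> number at most \<open>s\<close>, lie in a common bag of the
  tree-decomposition of the partition built so far, and extend to the branch sets of a clique
  outside \<open>C\<close>.  Call a subset of \<open>C\<close> colourful if it is adjacent to all these parts.  If there are
  \<open>s\<close> of them, then \<open>t\<close> disjoint connected colourful sets would give a minor in \<open>J_class s t\<close>, so
  \<open>t - 1\<close> bags meet every connected colourful set.  If there are fewer, a lowest node of the tree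
  below which a connected colourful set exists yields a subset of one bag such that every
  colourful component \<open>D\<close> it leaves has its neighbours in \<open>C\<close> inside a connected colourful set
  avoiding \<open>D\<close>.  In both cases a minimal such subset of \<open>C\<close> is the new part: minimality makes the
  clique model extend to every component left over, and a component that is not colourful has
  lost one of the old neighbouring parts in exchange for the new one.
\<close>

section \<open>Connected sets and components\<close>

text \<open>
  Connectedness of the subgraph induced by a set is stated through closed subsets rather than
  walks, so that most connectivity arguments reduce to set reasoning.
\<close>

definition connected_set :: "('a \<times> 'a) set \<Rightarrow> 'a set \<Rightarrow> bool" where
  "connected_set E S \<longleftrightarrow> S \<noteq> {} \<and> (\<forall>A\<subseteq>S. A \<noteq> {} \<longrightarrow> E `` A \<inter> S \<subseteq> A \<longrightarrow> S \<subseteq> A)"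

definition components :: "('a \<times> 'a) set \<Rightarrow> 'a set \<Rightarrow> 'a set set" where
  "components E U = {D. connected_set E D \<and> D \<subseteq> U \<and> E `` D \<inter> U \<subseteq> D}"

definition touches :: "('a \<times> 'a) set \<Rightarrow> 'a set \<Rightarrow> 'a set \<Rightarrow> bool" where
  "touches E A B \<longleftrightarrow> (\<exists>a\<in>A. \<exists>b\<in>B. (a, b) \<in> E)"

lemma touches_mono: "touches E A B \<Longrightarrow> A \<subseteq> A' \<Longrightarrow> B \<subseteq> B' \<Longrightarrow> touches E A' B'"
  unfolding touches_def by blast

lemma touches_commute: "sym E \<Longrightarrow> touches E A B \<longleftrightarrow> touches E B A"
  unfolding touches_def by (blast dest: symD)

lemma connected_setI:
  assumes "S \<noteq> {}" and "\<And>A. \<lbrakk>A \<subseteq> S; A \<noteq> {}; E `` A \<inter> S \<subseteq> A\<rbrakk> \<Longrightarrow> S \<subseteq> A"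
  shows "connected_set E S"
  using assms unfolding connected_set_def by blast

lemma connected_set_subset_closed:
  assumes "connected_set E S" "A \<inter> S \<noteq> {}" "E `` (A \<inter> S) \<inter> S \<subseteq> A"
  shows "S \<subseteq> A"
proof -
  have "A \<inter> S \<subseteq> S" "E `` (A \<inter> S) \<inter> S \<subseteq> A \<inter> S"
    using assms(3) by blast+
  with assms(1,2) have "S \<subseteq> A \<inter> S"
    unfolding connected_set_def by blast
  then show ?thesis by blast
qed

lemma connected_set_nonempty: "connected_set E S \<Longrightarrow> S \<noteq> {}"
  by (simp add: connected_set_def)

lemma connected_set_singleton: "connected_set E {x}"
  by (rule connected_setI) auto

lemma connected_set_mono:
  assumes "connected_set E S" "Restr E S \<subseteq> F"
  shows "connected_set F S"
proof (rule connected_setI)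
  show "S \<noteq> {}" using assms(1) by (rule connected_set_nonempty)
  show "S \<subseteq> A" if "A \<subseteq> S" "A \<noteq> {}" "F `` A \<inter> S \<subseteq> A" for A
    by (rule connected_set_subset_closed[OF assms(1)]) (use that assms(2) in blast)+
qed

lemma connected_set_image:
  assumes "connected_set E S"
    and "\<And>x y. \<lbrakk>x \<in> S; y \<in> S; (x, y) \<in> E; f x \<noteq> f y\<rbrakk> \<Longrightarrow> (f x, f y) \<in> F"
  shows "connected_set F (f ` S)"
proof (rule connected_setI)
  show "f ` S \<noteq> {}" using assms(1) connected_set_nonempty by blast
  fix A assume A: "A \<subseteq> f ` S" "A \<noteq> {}" "F `` A \<inter> f ` S \<subseteq> A"
  have "S \<subseteq> f -` A"
  proof (rule connected_set_subset_closed[OF assms(1)])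
    show "E `` (f -` A \<inter> S) \<inter> S \<subseteq> f -` A"
    proof
      fix y assume "y \<in> E `` (f -` A \<inter> S) \<inter> S"
      then obtain x where "f x \<in> A" "x \<in> S" "(x, y) \<in> E" "y \<in> S" by blast
      then show "y \<in> f -` A" using assms(2)[of x y] A(3) by (cases "f x = f y") auto
    qed
  qed (use A in blast)
  then show "f ` S \<subseteq> A" by blast
qed

lemma connected_set_UN:
  assumes "connected_set E I" and "\<And>i. i \<in> I \<Longrightarrow> connected_set F (B i)"
    and "\<And>i j. \<lbrakk>i \<in> I; j \<in> I; (i, j) \<in> E\<rbrakk> \<Longrightarrow> B i \<inter> B j \<noteq> {} \<or> touches F (B i) (B j)"
  shows "connected_set F (\<Union>i\<in>I. B i)"
proof (rule connected_setI)
  obtain i where "i \<in> I" using connected_set_nonempty[OF assms(1)] by blast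
  then show "(\<Union>i\<in>I. B i) \<noteq> {}" using connected_set_nonempty[OF assms(2)] by blast
  fix A assume A: "A \<subseteq> (\<Union>i\<in>I. B i)" "A \<noteq> {}" "F `` A \<inter> (\<Union>i\<in>I. B i) \<subseteq> A"
  have absorb: "B i \<subseteq> A" if "i \<in> I" "A \<inter> B i \<noteq> {}" for i
    by (rule connected_set_subset_closed[OF assms(2)]) (use that A(3) in blast)+
  have "I \<subseteq> {i. B i \<subseteq> A}"
  proof (rule connected_set_subset_closed[OF assms(1)])
    show "{i. B i \<subseteq> A} \<inter> I \<noteq> {}" using A(1,2) absorb by blast
    show "E `` ({i. B i \<subseteq> A} \<inter> I) \<inter> I \<subseteq> {i. B i \<subseteq> A}"
    proof
      fix j assume "j \<in> E `` ({i. B i \<subseteq> A} \<inter> I) \<inter> I"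
      then obtain i where i: "i \<in> I" "j \<in> I" "B i \<subseteq> A" "(i, j) \<in> E" by blast
      then have "A \<inter> B j \<noteq> {}"
        using assms(3)[of i j] A(3) unfolding touches_def by blast
      then show "j \<in> {i. B i \<subseteq> A}" using absorb i(2) by blast
    qed
  qed
  then show "(\<Union>i\<in>I. B i) \<subseteq> A" by blast
qed

lemma connected_set_UN_pairwise:
  assumes "I \<noteq> {}" and "\<And>i. i \<in> I \<Longrightarrow> connected_set E (B i)"
    and "pairwise (\<lambda>i j. B i \<inter> B j \<noteq> {} \<or> touches E (B i) (B j)) I"
  shows "connected_set E (\<Union>i\<in>I. B i)"
proof (rule connected_set_UN)
  show "connected_set UNIV I" by (rule connected_setI) (use assms(1) in auto)
  show "B i \<inter> B j \<noteq> {} \<or> touches E (B i) (B j)" if "i \<in> I" "j \<in> I" for i j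
    using that assms(3) connected_set_nonempty[OF assms(2)]
    by (cases "i = j") (auto simp: pairwise_def)
qed (use assms(2) in blast)

lemma connected_set_Un:
  assumes "sym E" "connected_set E A" "connected_set E B" "A \<inter> B \<noteq> {} \<or> touches E A B"
  shows "connected_set E (A \<union> B)"
proof -
  have "B \<inter> A \<noteq> {} \<or> touches E B A"
    using assms(4) touches_commute[OF assms(1)] by blast
  then have "connected_set E (\<Union>S\<in>{A, B}. S)"
    using assms(2-4) by (intro connected_set_UN_pairwise) (auto simp: pairwise_insert)
  then show ?thesis by simp
qed

lemma connected_set_insert:
  assumes "sym E" "connected_set E S" "x \<in> E `` S"
  shows "connected_set E (insert x S)"
  using connected_set_Un[OF assms(1,2) connected_set_singleton, of x] assms(3)
  by (auto simp: touches_def)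

lemma connected_set_touches_Diff:
  assumes "connected_set E S" "A \<subset> S" "A \<noteq> {}"
  shows "touches E A (S - A)"
  using connected_set_subset_closed[OF assms(1), of A] assms(2,3) unfolding touches_def by blast

lemma components_connected: "D \<in> components E U \<Longrightarrow> connected_set E D"
  and components_subset: "D \<in> components E U \<Longrightarrow> D \<subseteq> U"
  and components_closed: "D \<in> components E U \<Longrightarrow> E `` D \<inter> U \<subseteq> D"
  by (auto simp: components_def)

lemma components_nonempty: "D \<in> components E U \<Longrightarrow> D \<noteq> {}"
  by (blast dest: components_connected connected_set_nonempty)

lemma Union_components:
  assumes "sym E"
  shows "\<Union>(components E U) = U"
proof (intro equalityI subsetI)
  fix v assume v: "v \<in> U"
  define \<S> where "\<S> = {S. connected_set E S \<and> S \<subseteq> U \<and> v \<in> S}"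
  have "{v} \<in> \<S>" using v by (simp add: \<S>_def connected_set_singleton)
  then have "connected_set E (\<Union>S\<in>\<S>. S)"
    by (intro connected_set_UN_pairwise pairwiseI) (auto simp: \<S>_def)
  moreover have "E `` \<Union>\<S> \<inter> U \<subseteq> \<Union>\<S>"
  proof
    fix b assume "b \<in> E `` \<Union>\<S> \<inter> U"
    then obtain S where "S \<in> \<S>" "b \<in> E `` S" "b \<in> U" by blast
    then have "insert b S \<in> \<S>"
      using connected_set_insert[OF assms] by (simp add: \<S>_def)
    then show "b \<in> \<Union>\<S>" by blast
  qed
  ultimately have "\<Union>\<S> \<in> components E U"
    unfolding components_def by (auto simp: \<S>_def)
  then show "v \<in> \<Union>(components E U)" using \<open>{v} \<in> \<S>\<close> by blast
qed (use components_subset in blast)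

lemma connected_set_subset_component:
  assumes "connected_set E S" "S \<subseteq> U" "D \<in> components E U" "S \<inter> D \<noteq> {}"
  shows "S \<subseteq> D"
  by (rule connected_set_subset_closed[OF assms(1)])
    (use assms(2,4) components_closed[OF assms(3)] in blast)+

lemma obtain_component_superset:
  assumes "sym E" "connected_set E S" "S \<subseteq> U"
  obtains D where "D \<in> components E U" "S \<subseteq> D"
proof -
  obtain v where v: "v \<in> S" using connected_set_nonempty[OF assms(2)] by blast
  then obtain D where D: "D \<in> components E U" "v \<in> D"
    using Union_components[OF assms(1), of U] assms(3) by blast
  then have "S \<subseteq> D"
    using connected_set_subset_component[OF assms(2,3)] v by blast
  with D(1) show thesis by (rule that)
qed

lemma components_eqI:
  assumes "D \<in> components E U" "D' \<in> components E U" "D \<inter> D' \<noteq> {}"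
  shows "D = D'"
proof
  show "D \<subseteq> D'"
    using assms(1,3) components_connected components_subset
    by (intro connected_set_subset_component[OF _ _ assms(2)])
  show "D' \<subseteq> D"
    using assms(2,3) components_connected components_subset
    by (intro connected_set_subset_component[OF _ _ assms(1)]) blast+
qed

lemma components_not_touches:
  assumes "C \<in> components E U" "D \<in> components E U" "C \<noteq> D"
  shows "\<not> touches E C D"
  using components_eqI[OF assms(1,2)] components_closed[OF assms(1)] components_subset[OF assms(2)]
    assms(3)
  unfolding touches_def by blast

lemma component_touches_Diff:
  assumes "connected_set E S" "U \<subset> S" "D \<in> components E U"
  shows "touches E D (S - U)"
proof -
  have "touches E D (S - D)"
    by (rule connected_set_touches_Diff[OF assms(1)])
      (use assms(2) components_subset[OF assms(3)] components_nonempty[OF assms(3)] in blast)+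
  then show ?thesis
    using components_closed[OF assms(3)] unfolding touches_def by blast
qed

lemma components_Diff_subset:
  assumes "sym E" "C \<in> components E U" "Y \<subseteq> C"
  shows "components E (U - Y) \<subseteq> (components E U - {C}) \<union> components E (C - Y)"
proof
  fix D assume D: "D \<in> components E (U - Y)"
  note D_props = components_connected[OF D] components_subset[OF D] components_closed[OF D]
  have "C \<subseteq> U" using assms(2) by (rule components_subset)
  show "D \<in> (components E U - {C}) \<union> components E (C - Y)"
  proof (cases "D \<inter> C = {}")
    case True
    moreover have "E `` D \<inter> C \<subseteq> D"
      using True components_closed[OF assms(2)] D_props(2) assms(1) by (blast dest: symD)
    ultimately have "D \<in> components E U"
      using D_props assms(3) unfolding components_def by blast
    moreover have "D \<noteq> C" using True components_nonempty[OF D] by blast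
    ultimately show ?thesis by blast
  next
    case False
    then have "D \<subseteq> C"
      by (intro connected_set_subset_component[OF D_props(1) _ assms(2)]) (use D_props(2) in blast)+
    then have "D \<in> components E (C - Y)"
      using D_props \<open>C \<subseteq> U\<close> unfolding components_def by blast
    then show ?thesis by blast
  qed
qed

lemma connected_set_Un_components:
  assumes "sym E" "connected_set E B" and "\<And>D. D \<in> components E U \<Longrightarrow> touches E D B"
  shows "connected_set E (U \<union> B)"
proof -
  have "connected_set E (\<Union>D\<in>insert B (components E U). D \<union> B)"
  proof (rule connected_set_UN_pairwise)
    show "connected_set E (D \<union> B)" if "D \<in> insert B (components E U)" for D
      using that assms connected_set_Un[OF assms(1) components_connected[of D E U] assms(2)] by auto
    show "pairwise (\<lambda>D D'. (D \<union> B) \<inter> (D' \<union> B) \<noteq> {} \<or> touches E (D \<union> B) (D' \<union> B))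
        (insert B (components E U))"
      using connected_set_nonempty[OF assms(2)] by (auto intro: pairwiseI)
  qed simp
  also have "(\<Union>D\<in>insert B (components E U). D \<union> B) = U \<union> B"
    using Union_components[OF assms(1), of U] by blast
  finally show ?thesis .
qed

lemma connected_set_Diff_component:
  assumes "sym E" "connected_set E S" "z \<in> S" "Q \<in> components E (S - {z})"
  shows "connected_set E (S - Q)"
proof -
  have "connected_set E ((S - {z} - Q) \<union> {z})"
  proof (rule connected_set_Un_components[OF assms(1) connected_set_singleton])
    fix D assume D: "D \<in> components E (S - {z} - Q)"
    have "components E (Q - Q) = {}"
      using components_nonempty components_subset by fastforce
    then have "D \<in> components E (S - {z})"
      using components_Diff_subset[OF assms(1,4) subset_refl] D by blast
    then have "touches E D (S - (S - {z}))"
      by (intro component_touches_Diff[OF assms(2)]) (use assms(3) in blast)+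
    then show "touches E D {z}" by (rule touches_mono) blast+
  qed
  moreover have "(S - {z} - Q) \<union> {z} = S - Q"
    using assms(3) components_subset[OF assms(4)] by blast
  ultimately show ?thesis by simp
qed

definition connected_packing :: "('a \<times> 'a) set \<Rightarrow> 'a set \<Rightarrow> 'a set set \<Rightarrow> bool" where
  "connected_packing E C \<S> \<longleftrightarrow>
     finite \<S> \<and> disjoint \<S> \<and> (\<forall>S\<in>\<S>. connected_set E S \<and> S \<subseteq> C)"

lemma connected_packing_absorb_vertex:
  assumes "sym E" "connected_set E C" "connected_packing E C \<S>" "\<S> \<noteq> {}" "\<Union>\<S> \<noteq> C"
  obtains \<S>' where "connected_packing E C \<S>'" "card \<S>' = card \<S>" "\<Union>\<S> \<subset> \<Union>\<S>'"
    "\<forall>A\<in>\<S>'. \<exists>S\<in>\<S>. S \<subseteq> A"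
proof -
  have \<S>: "finite \<S>" "disjoint \<S>" "\<And>S. S \<in> \<S> \<Longrightarrow> connected_set E S \<and> S \<subseteq> C"
    using assms(3) by (auto simp: connected_packing_def)
  have "touches E (\<Union>\<S>) (C - \<Union>\<S>)"
    using assms(4,5) \<S>(3) connected_set_nonempty
    by (intro connected_set_touches_Diff[OF assms(2)]) blast+
  then obtain S a b where S: "S \<in> \<S>" "a \<in> S" and b: "b \<in> C - \<Union>\<S>" and ab: "(a, b) \<in> E"
    unfolding touches_def by blast
  let ?S = "insert b S"
  let ?\<S> = "insert ?S (\<S> - {S})"
  have "connected_set E ?S"
    using \<S>(3)[OF S(1)] S(2) ab by (intro connected_set_insert[OF assms(1)]) blast+
  then have "\<forall>A\<in>?\<S>. connected_set E A \<and> A \<subseteq> C" using \<S>(3) S(1) b by blast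
  moreover have "disjoint ?\<S>"
    using \<S>(2) S(1) b unfolding pairwise_insert by (auto simp: pairwise_def disjnt_def)
  ultimately have "connected_packing E C ?\<S>" using \<S>(1) by (simp add: connected_packing_def)
  moreover have "?S \<notin> \<S> - {S}" using b by blast
  then have "card ?\<S> = card \<S>" using \<S>(1) S(1) by (metis card.insert card.remove finite_Diff)
  moreover have "\<Union>\<S> \<subset> \<Union>?\<S>" using S(1) b by blast
  moreover have "\<forall>A\<in>?\<S>. \<exists>S\<in>\<S>. S \<subseteq> A" using S(1) by blast
  ultimately show thesis by (rule that)
qed

lemma connected_packing_extend_to_partition:
  assumes "sym E" "connected_set E C" "finite C" "connected_packing E C \<S>" "\<S> \<noteq> {}"
  shows "\<exists>\<B>. connected_packing E C \<B> \<and> \<Union>\<B> = C \<and> card \<B> = card \<S> \<and> (\<forall>B\<in>\<B>. \<exists>S\<in>\<S>. S \<subseteq> B)"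
  using assms(4,5)
proof (induction "card (C - \<Union>\<S>)" arbitrary: \<S> rule: less_induct)
  case less
  show ?case
  proof (cases "\<Union>\<S> = C")
    case True
    then show ?thesis using less.prems(1) by blast
  next
    case False
    obtain \<S>' where \<S>': "connected_packing E C \<S>'" "card \<S>' = card \<S>" "\<Union>\<S> \<subset> \<Union>\<S>'"
        "\<forall>A\<in>\<S>'. \<exists>S\<in>\<S>. S \<subseteq> A"
      by (rule connected_packing_absorb_vertex[OF assms(1,2) less.prems False])
    have "\<Union>\<S>' \<subseteq> C" using \<S>'(1) by (auto simp: connected_packing_def)
    then have "card (C - \<Union>\<S>') < card (C - \<Union>\<S>)"
      using assms(3) \<S>'(3) by (intro psubset_card_mono) blast+
    moreover have "\<S>' \<noteq> {}" using \<S>'(3) by blast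
    ultimately obtain \<B> where "connected_packing E C \<B>" "\<Union>\<B> = C" "card \<B> = card \<S>'"
        "\<forall>B\<in>\<B>. \<exists>A\<in>\<S>'. A \<subseteq> B"
      using less.hyps[OF _ \<S>'(1)] by blast
    then show ?thesis using \<S>'(2,4) by (metis subset_trans)
  qed
qed

section \<open>Connectivity in graphs\<close>

lemma pair_graph_iff:
  "pair_graph G \<longleftrightarrow>
     finite (pverts G) \<and> parcs G \<subseteq> pverts G \<times> pverts G \<and> sym (parcs G) \<and> irrefl (parcs G)"
  (is "_ \<longleftrightarrow> ?rhs")
proof
  assume "pair_graph G"
  then interpret pair_graph G .
  show ?rhs
    by (auto simp: sym_def irrefl_def intro: in_arcsD1 in_arcsD2 arcs_symmetric dest: no_loops')
next
  assume graph: ?rhs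
  then have "finite (parcs G)" by (meson finite_SigmaI finite_subset)
  then show "pair_graph G"
    using graph by unfold_locales (auto simp: irrefl_def symmetric_def)
qed

lemma pair_graph_finite: "pair_graph G \<Longrightarrow> finite (pverts G)"
  and pair_graph_sym: "pair_graph G \<Longrightarrow> sym (parcs G)"
  by (simp_all add: pair_graph_iff)

context pair_graph
begin

lemma arcs_ends_induce_subgraph: "arcs_ends (with_proj G \<restriction> S) = Restr (parcs G) S"
  by (auto simp: arcs_ends_def arc_to_ends_def)

lemma reachable_induce_subgraph:
  assumes "connected_set (parcs G) S" "u \<in> S" "v \<in> S"
  shows "u \<rightarrow>\<^sup>*\<^bsub>with_proj G \<restriction> S\<^esub> v"
proof -
  interpret H: wf_digraph "with_proj G \<restriction> S" by (rule wellformed_induce_subgraph)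
  have "S \<subseteq> {w. u \<rightarrow>\<^sup>*\<^bsub>with_proj G \<restriction> S\<^esub> w}"
  proof (rule connected_set_subset_closed[OF assms(1)])
    have "u \<rightarrow>\<^sup>*\<^bsub>with_proj G \<restriction> S\<^esub> u" using assms(2) by (intro H.reachable_refl) simp
    then show "{w. u \<rightarrow>\<^sup>*\<^bsub>with_proj G \<restriction> S\<^esub> w} \<inter> S \<noteq> {}" using assms(2) by blast
    show "parcs G `` ({w. u \<rightarrow>\<^sup>*\<^bsub>with_proj G \<restriction> S\<^esub> w} \<inter> S) \<inter> S \<subseteq> {w. u \<rightarrow>\<^sup>*\<^bsub>with_proj G \<restriction> S\<^esub> w}"
      by (auto simp: arcs_ends_induce_subgraph intro: H.reachable_adj_trans)
  qed
  with assms(3) show ?thesis by blast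
qed

lemma connected_induce_subgraph_iff:
  assumes "S \<subseteq> pverts G"
  shows "connected (with_proj G \<restriction> S) \<longleftrightarrow> connected_set (parcs G) S"
proof -
  let ?H = "with_proj G \<restriction> S"
  interpret H: wf_digraph ?H by (rule wellformed_induce_subgraph)
  have "symmetric ?H"
    by (rule induced_graph_imp_symmetric[OF sym_arcs]) (use assms in \<open>auto intro: induced_induce\<close>)
  then have "connected ?H \<longleftrightarrow> strongly_connected ?H"
    unfolding connected_def strongly_connected_def by (simp add: H.reachable_mk_symmetric_eq)
  also have "\<dots> \<longleftrightarrow> connected_set (parcs G) S"
  proof
    assume reach: "strongly_connected ?H"
    show "connected_set (parcs G) S"
    proof (rule connected_setI)
      show "S \<noteq> {}" using reach by (simp add: strongly_connected_def)
      fix A assume A: "A \<subseteq> S" "A \<noteq> {}" "parcs G `` A \<inter> S \<subseteq> A"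
      then obtain a where a: "a \<in> A" by blast
      have "v \<in> A" if "a \<rightarrow>\<^sup>*\<^bsub>?H\<^esub> v" for v
        using that by (induction rule: H.reachable_induct)
          (use a A(3) in \<open>auto simp: arcs_ends_induce_subgraph\<close>)
      then show "S \<subseteq> A"
        using reach a A(1) by (auto simp: strongly_connected_def)
    qed
  next
    assume "connected_set (parcs G) S"
    then show "strongly_connected ?H"
      by (intro strongly_connectedI)
        (auto intro: reachable_induce_subgraph dest: connected_set_nonempty)
  qed
  finally show ?thesis .
qed

lemma connected_iff: "connected (with_proj G) \<longleftrightarrow> connected_set (parcs G) (pverts G)"
proof -
  have "with_proj G \<restriction> pverts G = with_proj G"
    by (auto simp: induce_subgraph_def with_proj_def intro: in_arcsD1 in_arcsD2)
  then show ?thesis using connected_induce_subgraph_iff[of "pverts G"] by simp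
qed

end

section \<open>Trees\<close>

text \<open>Acyclicity without walks: two edges into a connected set would close a cycle.\<close>

definition forest_edges :: "('a \<times> 'a) set \<Rightarrow> bool" where
  "forest_edges E \<longleftrightarrow>
     (\<forall>S z. connected_set E S \<longrightarrow> z \<notin> S \<longrightarrow> (\<forall>y\<in>S. \<forall>y'\<in>S. (z, y) \<in> E \<longrightarrow> (z, y') \<in> E \<longrightarrow> y = y'))"

lemma forest_edgesD:
  "\<lbrakk>forest_edges E; connected_set E S; z \<notin> S; y \<in> S; y' \<in> S; (z, y) \<in> E; (z, y') \<in> E\<rbrakk> \<Longrightarrow> y = y'"
  unfolding forest_edges_def by blast

context pair_graph
begin

lemma connected_set_awalk_verts:
  assumes "awalk u p v"
  shows "connected_set (parcs G) (set (awalk_verts u p))"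
  using assms
proof (induction p arbitrary: u)
  case Nil
  then show ?case by (simp add: connected_set_singleton)
next
  case (Cons e p)
  then have e: "e \<in> parcs G" "u = fst e" and walk: "awalk (snd e) p v"
    by (simp_all add: awalk_Cons_iff)
  have "(snd e, u) \<in> parcs G" using e by (cases e) (auto intro: arcs_symmetric)
  then have "u \<in> parcs G `` set (awalk_verts (snd e) p)"
    using hd_in_awalk_verts(1)[OF walk] by blast
  then have "connected_set (parcs G) (insert u (set (awalk_verts (snd e) p)))"
    using Cons.IH[OF walk] pair_graph_sym[OF pair_graph] by (intro connected_set_insert)
  then show ?case using e by simp
qed

lemma cycle_imp_not_forest_edges:
  assumes "cycle p" "3 \<le> length p"
  shows "\<not> forest_edges (parcs G)"
proof
  assume forest: "forest_edges (parcs G)"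
  obtain u where walk: "awalk u p u" and distinct: "distinct (tl (awalk_verts u p))"
    using assms(1) by (auto simp: cycle_def)
  obtain e p' where p': "p = e # p'" "2 \<le> length p'" using assms(2) by (cases p) auto
  then obtain q d where q: "p' = q @ [d]" "q \<noteq> []" by (cases p' rule: rev_cases) force+
  define y y' where "y = snd e" and "y' = fst d"
  have e: "e = (u, y)" "e \<in> parcs G" and d: "d = (y', u)" "d \<in> parcs G" and q_walk: "awalk y q y'"
    using walk p'(1) q(1) by (auto simp: awalk_Cons_iff awalk_Nil_iff y_def y'_def prod_eq_iff)
  have "tl (awalk_verts u p) = awalk_verts y q @ [u]"
    using awalk_verts_append[of y q "[d]" u] q_walk d p'(1) q(1)
    by (simp add: awalk_Cons_iff awalk_Nil_iff e awalk_hd_in_verts[OF walk])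
  then have u: "u \<notin> set (awalk_verts y q)" and path: "apath y q y'"
    using distinct q_walk by (simp_all add: apath_def)
  have "y \<noteq> y'" using path q(2) by (rule apath_nonempty_ends)
  moreover have "y = y'"
  proof (rule forest_edgesD[OF forest connected_set_awalk_verts[OF q_walk] u])
    show "y \<in> set (awalk_verts y q)" using q_walk by (rule hd_in_awalk_verts(1))
    show "y' \<in> set (awalk_verts y q)"
      using last_in_set[OF awalk_verts_non_Nil, of y q] q_walk by simp
    show "(u, y) \<in> parcs G" "(u, y') \<in> parcs G"
      using e d arcs_symmetric by auto
  qed
  ultimately show False by simp
qed

lemma not_forest_edges_imp_cycle:
  assumes "\<not> forest_edges (parcs G)"
  obtains p where "cycle p" "3 \<le> length p"
proof -
  obtain S z y y' where S: "connected_set (parcs G) S" "z \<notin> S" "y \<in> S" "y' \<in> S"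
    and zy: "(z, y) \<in> parcs G" "(z, y') \<in> parcs G" and ne: "y \<noteq> y'"
    using assms unfolding forest_edges_def by blast
  have "S \<subseteq> pverts G"
    by (rule connected_set_subset_closed[OF S(1)]) (use S(3) zy(1) in \<open>auto dest: in_arcsD2\<close>)
  then have sub: "subgraph (with_proj G \<restriction> S) (with_proj G)" by (rule subgraph_induce_subgraphI)
  interpret H: wf_digraph "with_proj G \<restriction> S" by (rule wellformed_induce_subgraph)
  obtain p where p: "H.apath y p y'"
    using reachable_induce_subgraph[OF S(1,3,4)] by (auto simp: H.reachable_apath)
  then have "apath y p y'" using sub by (rule subgraph_apath_imp_apath)
  then have path: "awalk y p y'" "distinct (awalk_verts y p)" by (simp_all add: apath_def)
  have "set (awalk_verts y p) \<subseteq> S"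
    using H.awalk_verts_in_verts[of y p] p
    by (auto simp: H.apath_def H.awalk_def awalk_verts_induce)
  then have z: "z \<notin> set (awalk_verts y p)" using S(2) by blast
  let ?c = "(z, y) # p @ [(y', z)]"
  have closing: "(y', z) \<in> parcs G" using zy(2) by (rule arcs_symmetric)
  have walk: "awalk y (p @ [(y', z)]) z"
    using path(1) closing by (auto simp: awalk_Cons_iff awalk_Nil_iff dest: in_arcsD2)
  have "tl (awalk_verts z ?c) = awalk_verts y p @ [z]"
    using awalk_verts_append[OF walk] path(1) by simp
  then have "cycle ?c"
    using walk zy(1) path z unfolding cycle_def
    by (intro exI[of _ z]) (simp add: awalk_Cons_iff)
  moreover have "p \<noteq> []" using path(1) ne by (auto simp: awalk_Nil_iff)
  then have "3 \<le> length ?c" by (cases p) auto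
  ultimately show thesis by (rule that)
qed

end

lemma graph_tree_iff:
  "graph_tree T \<longleftrightarrow> pair_graph T \<and> connected_set (parcs T) (pverts T) \<and> forest_edges (parcs T)"
proof (cases "pair_graph T")
  case True
  interpret pair_graph T by fact
  show ?thesis
    unfolding graph_tree_def connected_iff
    using cycle_imp_not_forest_edges not_forest_edges_imp_cycle True by metis
qed (simp add: graph_tree_def)

definition add_leaf :: "'a pair_pre_digraph \<Rightarrow> 'a \<Rightarrow> 'a \<Rightarrow> 'a pair_pre_digraph" where
  "add_leaf T x l = \<lparr>pverts = insert l (pverts T), parcs = parcs T \<union> {(x, l), (l, x)}\<rparr>"

lemma add_leaf_simps [simp]:
  "pverts (add_leaf T x l) = insert l (pverts T)"
  "parcs (add_leaf T x l) = parcs T \<union> {(x, l), (l, x)}"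
  by (simp_all add: add_leaf_def)

lemma connected_set_Diff_leaf:
  assumes "E \<subseteq> V \<times> V" "x \<in> V" "l \<notin> V"
    and "connected_set (E \<union> {(x, l), (l, x)}) S" "x \<in> S"
  shows "connected_set E (S - {l})"
proof -
  have "connected_set E ((\<lambda>v. if v = l then x else v) ` S)"
    by (rule connected_set_image[OF assms(4)]) (use assms(1,3) in auto)
  also have "(\<lambda>v. if v = l then x else v) ` S = S - {l}"
    using assms(2,3,5) by (auto split: if_splits)
  finally show ?thesis .
qed

lemma forest_edges_add_leaf:
  assumes "forest_edges E" "E \<subseteq> V \<times> V" "x \<in> V" "l \<notin> V"
  shows "forest_edges (E \<union> {(x, l), (l, x)})" (is "forest_edges ?F")
  unfolding forest_edges_def
proof (intro allI ballI impI)
  fix S z y y'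
  assume S: "connected_set ?F S" "z \<notin> S" "y \<in> S" "y' \<in> S"
    and zy: "(z, y) \<in> ?F" "(z, y') \<in> ?F"
  consider (no_leaf) "l \<notin> S" | (both) "l \<in> S" "x \<in> S" | (leaf_only) "l \<in> S" "x \<notin> S" by blast
  then show "y = y'"
  proof cases
    case no_leaf
    show ?thesis
    proof (cases "z = l")
      case True
      then show ?thesis using zy assms(2,4) by auto
    next
      case False
      have "connected_set E S" by (rule connected_set_mono[OF S(1)]) (use no_leaf in auto)
      then show ?thesis
        by (rule forest_edgesD[OF assms(1), where z = z]) (use S zy no_leaf False in auto)
    qed
  next
    case both
    then have "connected_set E (S - {l})"
      using assms(2-4) S(1) by (intro connected_set_Diff_leaf)
    then show ?thesis
      by (rule forest_edgesD[OF assms(1), where z = z]) (use S zy both assms(2,4) in auto)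
  next
    case leaf_only
    have "S \<subseteq> {l}"
      by (rule connected_set_subset_closed[OF S(1)]) (use leaf_only assms(2,4) in auto)
    then show ?thesis using S(3,4) by blast
  qed
qed

lemma connected_set_insert_leaf:
  assumes "sym (parcs T)" "connected_set (parcs T) S" "x \<in> S"
  shows "connected_set (parcs (add_leaf T x l)) (insert l S)"
proof (rule connected_set_insert)
  show "sym (parcs (add_leaf T x l))" using assms(1) by (auto simp: sym_def)
  show "connected_set (parcs (add_leaf T x l)) S" by (rule connected_set_mono[OF assms(2)]) auto
qed (use assms(3) in auto)

lemma graph_tree_add_leaf:
  assumes "graph_tree T" "x \<in> pverts T" "l \<notin> pverts T"
  shows "graph_tree (add_leaf T x l)"
proof -
  have T: "finite (pverts T)" "parcs T \<subseteq> pverts T \<times> pverts T" "sym (parcs T)" "irrefl (parcs T)"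
    and conn: "connected_set (parcs T) (pverts T)" and forest: "forest_edges (parcs T)"
    using assms(1) unfolding graph_tree_iff pair_graph_iff by auto
  have "pair_graph (add_leaf T x l)"
    using T assms(2,3) unfolding pair_graph_iff by (auto simp: sym_def irrefl_def)
  then show ?thesis
    using connected_set_insert_leaf[OF T(3) conn assms(2)]
      forest_edges_add_leaf[OF forest T(2) assms(2,3)]
    unfolding graph_tree_iff by simp
qed

lemma graph_tree_singleton: "graph_tree \<lparr>pverts = {x}, parcs = {}\<rparr>"
  by (auto simp: graph_tree_iff pair_graph_iff connected_set_singleton forest_edges_def
      sym_def irrefl_def)

locale rooted_tree =
  fixes T :: "'b pair_pre_digraph" and r :: 'b
  assumes tree: "graph_tree T" and root: "r \<in> pverts T"
begin

lemma pair_graph_tree: "pair_graph T"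
  and connected_nodes: "connected_set (parcs T) (pverts T)"
  and forest_tree: "forest_edges (parcs T)"
  using tree unfolding graph_tree_iff by auto

lemmas finite_nodes = pair_graph_finite[OF pair_graph_tree]
  and sym_tree = pair_graph_sym[OF pair_graph_tree]

text \<open>For \<open>z = r\<close> no component contains \<open>r\<close>, so that all nodes are descendants of the root.\<close>

definition descendants :: "'b \<Rightarrow> 'b set" where
  "descendants z = pverts T - \<Union>{K \<in> components (parcs T) (pverts T - {z}). r \<in> K}"

lemma descendants_subset: "descendants z \<subseteq> pverts T"
  by (auto simp: descendants_def)

lemma descendants_root: "descendants r = pverts T"
  using components_subset by (fastforce simp: descendants_def)

lemma descendants_self: "z \<in> pverts T \<Longrightarrow> z \<in> descendants z"
  using components_subset by (fastforce simp: descendants_def)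

lemma connected_set_subset_descendants:
  assumes "connected_set (parcs T) P" "P \<subseteq> pverts T - {z}" "P \<inter> descendants z \<noteq> {}"
  shows "P \<subseteq> descendants z"
proof (rule ccontr)
  assume "\<not> P \<subseteq> descendants z"
  then obtain K where K: "K \<in> components (parcs T) (pverts T - {z})" "r \<in> K" "P \<inter> K \<noteq> {}"
    using assms(2) unfolding descendants_def by blast
  then have "P \<subseteq> K" by (intro connected_set_subset_component[OF assms(1,2)])
  then show False using assms(3) K unfolding descendants_def by blast
qed

lemma component_subset_descendants:
  assumes Q: "Q \<in> components (parcs T) (pverts T - {z})" "r \<notin> Q"
    and y: "y \<in> Q" "(y, z) \<in> parcs T"
  shows "Q \<subseteq> descendants y"
proof (rule ccontr)
  assume "\<not> Q \<subseteq> descendants y"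
  then obtain K where K: "K \<in> components (parcs T) (pverts T - {y})" "r \<in> K" "K \<inter> Q \<noteq> {}"
    using components_subset[OF Q(1)] unfolding descendants_def by blast
  then have "touches (parcs T) (K \<inter> Q) (K - K \<inter> Q)"
    using Q(2) by (intro connected_set_touches_Diff[OF components_connected[OF K(1)]]) blast+
  then obtain a c where ac: "a \<in> K" "a \<in> Q" "c \<in> K - Q" "(a, c) \<in> parcs T"
    unfolding touches_def by blast
  have "c = z" using ac components_closed[OF Q(1)] components_subset[OF K(1)] by blast
  have "a = y"
  proof (rule forest_edgesD[OF forest_tree components_connected[OF Q(1)] _ ac(2) y(1)])
    show "z \<notin> Q" using components_subset[OF Q(1)] by blast
    show "(z, a) \<in> parcs T" "(z, y) \<in> parcs T"
      using ac(4) y(2) sym_tree \<open>c = z\<close> by (auto dest: symD)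
  qed
  then show False using ac(1) components_subset[OF K(1)] by blast
qed

lemma descendants_subset_component:
  assumes "z \<in> pverts T" "Q \<in> components (parcs T) (pverts T - {z})" "r \<notin> Q" "y \<in> Q"
  shows "descendants y \<subseteq> Q"
proof -
  have "connected_set (parcs T) (pverts T - Q)"
    by (rule connected_set_Diff_component[OF sym_tree connected_nodes assms(1,2)])
  then obtain K where "K \<in> components (parcs T) (pverts T - {y})" "pverts T - Q \<subseteq> K"
    by (rule obtain_component_superset[OF sym_tree, where U = "pverts T - {y}"])
      (use assms(4) in blast)
  then show ?thesis using root assms(3) unfolding descendants_def by blast
qed

lemma component_eq_descendants:
  assumes z: "z \<in> pverts T" and Q: "Q \<in> components (parcs T) (pverts T - {z})" "r \<notin> Q"
  obtains y where "y \<in> pverts T" "descendants y = Q"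
proof -
  have "touches (parcs T) Q (pverts T - (pverts T - {z}))"
    by (rule component_touches_Diff[OF connected_nodes _ Q(1)]) (use z in blast)
  then obtain y where y: "y \<in> Q" "(y, z) \<in> parcs T" unfolding touches_def by blast
  have "descendants y = Q"
    using component_subset_descendants[OF Q y] descendants_subset_component[OF z Q y(1)] by blast
  moreover have "y \<in> pverts T" using y(1) components_subset[OF Q(1)] by blast
  ultimately show thesis using that by blast
qed

lemma connected_set_below_child:
  assumes z: "z \<in> pverts T" and P: "connected_set (parcs T) P" "P \<subseteq> descendants z - {z}"
  obtains y where "y \<in> pverts T" "P \<subseteq> descendants y" "descendants y \<subset> descendants z"
proof -
  have "P \<subseteq> pverts T - {z}" using P(2) descendants_subset by blast
  then obtain Q where Q: "Q \<in> components (parcs T) (pverts T - {z})" "P \<subseteq> Q"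
    by (rule obtain_component_superset[OF sym_tree P(1)])
  have "Q \<inter> descendants z \<noteq> {}"
    using P Q(2) connected_set_nonempty by blast
  then have Qz: "Q \<subseteq> descendants z"
    using components_connected[OF Q(1)] components_subset[OF Q(1)]
    by (intro connected_set_subset_descendants)
  then have "r \<notin> Q" using Q(1) components_nonempty unfolding descendants_def by blast
  then obtain y where y: "y \<in> pverts T" "descendants y = Q"
    by (rule component_eq_descendants[OF z Q(1)])
  moreover have "z \<in> descendants z - Q"
    using descendants_self[OF z] components_subset[OF Q(1)] by blast
  ultimately show thesis using that[of y] Q(2) Qz by blast
qed

end

section \<open>Minors\<close>

definition quotient_graph :: "'a pair_pre_digraph \<Rightarrow> ('a \<Rightarrow> 'b) \<Rightarrow> 'b pair_pre_digraph" where
  "quotient_graph G f = \<lparr>pverts = f ` pverts G, parcs = map_prod f f ` parcs G - Id\<rparr>"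

definition connected_fibres :: "'a pair_pre_digraph \<Rightarrow> ('a \<Rightarrow> 'b) \<Rightarrow> bool" where
  "connected_fibres G f \<longleftrightarrow> (\<forall>v\<in>pverts G. connected_set (parcs G) {w \<in> pverts G. f w = f v})"

lemma quotient_graph_simps [simp]:
  "pverts (quotient_graph G f) = f ` pverts G"
  "parcs (quotient_graph G f) = map_prod f f ` parcs G - Id"
  by (simp_all add: quotient_graph_def)

lemma pair_graph_quotient_graph:
  assumes "pair_graph G"
  shows "pair_graph (quotient_graph G f)"
proof -
  have G: "finite (pverts G)" "parcs G \<subseteq> pverts G \<times> pverts G" "sym (parcs G)"
    using assms unfolding pair_graph_iff by auto
  have "sym (map_prod f f ` parcs G - Id)"
    using G(3) by (force simp: sym_def)
  then show ?thesis
    using G(1,2) unfolding pair_graph_iff by (auto simp: irrefl_def)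
qed

lemma quotient_graph_comp: "quotient_graph (quotient_graph G f) g = quotient_graph G (g \<circ> f)"
proof -
  have "map_prod g g ` (map_prod f f ` parcs G - Id) - Id =
      map_prod g g ` map_prod f f ` parcs G - Id"
    by auto
  also have "\<dots> = map_prod (g \<circ> f) (g \<circ> f) ` parcs G - Id"
    by (simp only: image_comp map_prod.comp)
  finally show ?thesis by (simp add: quotient_graph_def image_comp)
qed

lemma quotient_graph_cong:
  assumes "pair_graph G" "\<And>v. v \<in> pverts G \<Longrightarrow> f v = g v"
  shows "quotient_graph G f = quotient_graph G g"
proof -
  have "map_prod f f ` parcs G = map_prod g g ` parcs G"
    using assms by (intro image_cong) (auto simp: pair_graph_iff)
  then show ?thesis using assms(2) by (simp add: quotient_graph_def)
qed

lemma quotient_graph_id: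
  assumes "pair_graph G"
  shows "quotient_graph G id = G"
proof (rule pair_pre_digraph.equality)
  show "parcs (quotient_graph G id) = parcs G"
    using assms by (auto simp: pair_graph_iff irrefl_def map_prod.id)
qed simp_all

lemma contract_edge_eq_quotient_graph:
  assumes "u \<in> pverts G" "u \<noteq> v" "v \<in> pverts G"
  shows "contract_edge G u v = quotient_graph G (id(v := u))"
  using assms by (auto simp: contract_edge_def quotient_graph_def)

lemma digraph_iso_quotient_graph:
  assumes "pair_graph G" "inj_on f (pverts G)"
  shows "digraph_iso (with_proj G) (with_proj (quotient_graph G f))"
proof -
  interpret pair_graph G by fact
  let ?h = "\<lparr>iso_verts = f, iso_arcs = map_prod f f, iso_head = snd, iso_tail = fst\<rparr>"
  have arcs: "parcs G \<subseteq> pverts G \<times> pverts G" "irrefl (parcs G)"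
    using assms(1) unfolding pair_graph_iff by auto
  then have "inj_on (map_prod f f) (parcs G)"
    using map_prod_inj_on[OF assms(2,2)] by (blast intro: inj_on_subset)
  then have "digraph_isomorphism ?h"
    using assms(2) wf_digraph_axioms unfolding digraph_isomorphism_def by auto
  moreover have "map_prod f f ` parcs G \<inter> Id = {}"
    using arcs assms(2) by (auto simp: irrefl_def dest!: inj_onD)
  then have "with_proj (quotient_graph G f) = app_iso ?h (with_proj G)"
    by (auto simp: app_iso_def with_proj_def)
  ultimately show ?thesis unfolding digraph_iso_def by blast
qed

lemma connected_fibres_quotient_graph:
  assumes "connected_fibres G (g \<circ> f)"
  shows "connected_fibres (quotient_graph G f) g"
  unfolding connected_fibres_def
proof
  fix u assume "u \<in> pverts (quotient_graph G f)"
  then obtain v where v: "v \<in> pverts G" "u = f v" by auto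
  then have "connected_set (parcs G) {w \<in> pverts G. g (f w) = g u}"
    using assms by (simp add: connected_fibres_def)
  then have "connected_set (parcs (quotient_graph G f)) (f ` {w \<in> pverts G. g (f w) = g u})"
    by (rule connected_set_image) force
  also have "f ` {w \<in> pverts G. g (f w) = g u} = {w \<in> pverts (quotient_graph G f). g w = g u}"
    by auto
  finally show
    "connected_set (parcs (quotient_graph G f)) {w \<in> pverts (quotient_graph G f). g w = g u}" .
qed

text \<open>Only an edge at a fixed point of \<open>f\<close> is contracted, so \<open>f\<close> remains a retraction.\<close>

lemma obtain_contraction_step:
  assumes "connected_fibres G f" "w \<in> pverts G" "f w \<in> pverts G" "f (f w) = f w" "f w \<noteq> w"
  obtains v where "v \<in> pverts G" "v \<noteq> f w" "f v = f w"
    "edge_contraction G (quotient_graph G (id(v := f w)))"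
proof -
  let ?S = "{v \<in> pverts G. f v = f w}"
  have "connected_set (parcs G) ?S"
    using assms(1,2) by (simp add: connected_fibres_def)
  moreover have "f w \<in> ?S" "w \<in> ?S - {f w}" using assms(2-5) by auto
  then have "{f w} \<subset> ?S" by blast
  ultimately have "touches (parcs G) {f w} (?S - {f w})"
    by (rule connected_set_touches_Diff) simp
  then obtain v where v: "v \<in> pverts G" "f v = f w" "v \<noteq> f w" "(f w, v) \<in> parcs G"
    unfolding touches_def by blast
  moreover have "edge_contraction G (quotient_graph G (id(v := f w)))"
    unfolding edge_contraction_def
    using contract_edge_eq_quotient_graph[OF assms(3) v(3)[symmetric] v(1)] v(4) by metis
  ultimately show thesis using that by blast
qed

lemma edge_contractions_quotient_graph:
  assumes "pair_graph G" "connected_fibres G f" "f ` pverts G \<subseteq> pverts G"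
    and "\<And>v. v \<in> pverts G \<Longrightarrow> f (f v) = f v"
  shows "edge_contraction\<^sup>*\<^sup>* G (quotient_graph G f)"
  using assms
proof (induction "card (pverts G)" arbitrary: G rule: less_induct)
  case less
  show ?case
  proof (cases "\<forall>v\<in>pverts G. f v = v")
    case True
    then have "quotient_graph G f = quotient_graph G id"
      by (intro quotient_graph_cong[OF less.prems(1)]) simp
    then show ?thesis using quotient_graph_id[OF less.prems(1)] by simp
  next
    case False
    then obtain w where w: "w \<in> pverts G" "f w \<noteq> w" by blast
    have fw: "f w \<in> pverts G" "f (f w) = f w" using less.prems(3,4) w(1) by auto
    then obtain v where v: "v \<in> pverts G" "v \<noteq> f w" "f v = f w"
        and step: "edge_contraction G (quotient_graph G (id(v := f w)))"
      using obtain_contraction_step[OF less.prems(2) w(1) _ _ w(2)] by metis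
    let ?G = "quotient_graph G (id(v := f w))"
    have absorb: "f \<circ> id(v := f w) = f" using fw(2) v(3) by auto
    have verts: "pverts ?G = pverts G - {v}" using fw(1) v(2) by auto
    have "edge_contraction\<^sup>*\<^sup>* ?G (quotient_graph ?G f)"
    proof (rule less.hyps)
      show "card (pverts ?G) < card (pverts G)"
        unfolding verts using pair_graph_finite[OF less.prems(1)] v(1) by (intro card_Diff1_less)
      show "pair_graph ?G" using less.prems(1) by (rule pair_graph_quotient_graph)
      show "connected_fibres ?G f"
        using less.prems(2) absorb by (intro connected_fibres_quotient_graph) simp
      have "f x \<noteq> v" if "x \<in> pverts G" for x using less.prems(4)[OF that] v(2,3) by auto
      then show "f ` pverts ?G \<subseteq> pverts ?G" using less.prems(3) unfolding verts by blast
      show "f (f x) = f x" if "x \<in> pverts ?G" for x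
        using that less.prems(4) unfolding verts by blast
    qed
    then have "edge_contraction\<^sup>*\<^sup>* ?G (quotient_graph G f)"
      unfolding quotient_graph_comp absorb .
    with step show ?thesis by (rule converse_rtranclp_into_rtranclp)
  qed
qed

lemma minor_quotient_graph:
  assumes "pair_graph G" "subgraph (with_proj G) (with_proj G')" "connected_fibres G f"
  shows "minor (quotient_graph G f) G'"
proof -
  define g where "g = inv_into (pverts G) f \<circ> f"
  have g: "g v \<in> pverts G" "f (g v) = f v" if "v \<in> pverts G" for v
    using that by (auto simp: g_def inv_into_into f_inv_into_f)
  have g_eq_iff: "g w = g v \<longleftrightarrow> f w = f v" if "v \<in> pverts G" "w \<in> pverts G" for v w
    using that g(2) by (metis comp_apply g_def)
  have "connected_fibres G g"
    using assms(3) unfolding connected_fibres_def by (simp add: g_eq_iff cong: conj_cong)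
  then have "edge_contraction\<^sup>*\<^sup>* G (quotient_graph G g)"
    using g by (intro edge_contractions_quotient_graph[OF assms(1)]) (auto simp: g_eq_iff)
  moreover have "digraph_iso (with_proj (quotient_graph G g))
      (with_proj (quotient_graph (quotient_graph G g) f))"
    by (rule digraph_iso_quotient_graph[OF pair_graph_quotient_graph[OF assms(1)]])
      (auto simp: inj_on_def g g_eq_iff)
  moreover have "quotient_graph (quotient_graph G g) f = quotient_graph G f"
    unfolding quotient_graph_comp by (rule quotient_graph_cong[OF assms(1)]) (simp add: g)
  ultimately show ?thesis
    unfolding minor_def using assms(1,2) by metis
qed

definition contact_graph :: "('a \<times> 'a) set \<Rightarrow> 'a set set \<Rightarrow> 'a set pair_pre_digraph" where
  "contact_graph E \<P> = \<lparr>pverts = \<P>, parcs = {(P, Q) \<in> \<P> \<times> \<P>. P \<noteq> Q \<and> touches E P Q}\<rparr>"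

lemma contact_graph_simps [simp]:
  "pverts (contact_graph E \<P>) = \<P>"
  "parcs (contact_graph E \<P>) = {(P, Q) \<in> \<P> \<times> \<P>. P \<noteq> Q \<and> touches E P Q}"
  by (simp_all add: contact_graph_def)

lemma pair_graph_contact_graph:
  assumes "finite \<P>" "sym E"
  shows "pair_graph (contact_graph E \<P>)"
proof -
  have "sym (parcs (contact_graph E \<P>))"
    using touches_commute[OF assms(2)] by (intro symI) (simp, blast)
  then show ?thesis using assms(1) unfolding pair_graph_iff by (auto simp: irrefl_def)
qed

lemma connected_set_contact_graph:
  assumes "partition_on C \<B>" "\<B> \<subseteq> \<P>" "connected_set E C"
  shows "connected_set (parcs (contact_graph E \<P>)) \<B>"
proof (rule connected_setI)
  have C: "C = \<Union>\<B>" and disj: "disjoint \<B>" and "{} \<notin> \<B>"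
    using assms(1) by (auto simp: partition_on_def)
  show "\<B> \<noteq> {}" using connected_set_nonempty[OF assms(3)] C by blast
  fix \<A> assume \<A>: "\<A> \<subseteq> \<B>" "\<A> \<noteq> {}" "parcs (contact_graph E \<P>) `` \<A> \<inter> \<B> \<subseteq> \<A>"
  have "C \<subseteq> \<Union>\<A>"
  proof (rule connected_set_subset_closed[OF assms(3)])
    obtain A where "A \<in> \<A>" "A \<noteq> {}" using \<A>(1,2) \<open>{} \<notin> \<B>\<close> by blast
    then show "\<Union>\<A> \<inter> C \<noteq> {}" using \<A>(1) C by blast
    show "E `` (\<Union>\<A> \<inter> C) \<inter> C \<subseteq> \<Union>\<A>"
    proof
      fix b assume "b \<in> E `` (\<Union>\<A> \<inter> C) \<inter> C"
      then obtain a A B where "A \<in> \<A>" "a \<in> A" "(a, b) \<in> E" "B \<in> \<B>" "b \<in> B" using C by blast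
      moreover from this have "touches E A B" unfolding touches_def by blast
      ultimately have "A = B \<or> B \<in> parcs (contact_graph E \<P>) `` \<A>"
        using \<A>(1) assms(2) unfolding Image_iff contact_graph_simps by blast
      then have "B \<in> \<A>" using \<open>A \<in> \<A>\<close> \<open>B \<in> \<B>\<close> \<A>(3) by blast
      then show "b \<in> \<Union>\<A>" using \<open>b \<in> B\<close> by blast
    qed
  qed
  show "\<B> \<subseteq> \<A>"
  proof
    fix B assume B: "B \<in> \<B>"
    then obtain b where b: "b \<in> B" using \<open>{} \<notin> \<B>\<close> by (metis equals0I)
    then obtain A where "A \<in> \<A>" "b \<in> A" using \<open>C \<subseteq> \<Union>\<A>\<close> C B by blast
    then show "B \<in> \<A>" using disjointD[OF disj B, of A] \<A>(1) b by blast
  qed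
qed

definition induced_graph :: "'a pair_pre_digraph \<Rightarrow> 'a set \<Rightarrow> 'a pair_pre_digraph" where
  "induced_graph G U = \<lparr>pverts = U, parcs = Restr (parcs G) U\<rparr>"

lemma induced_graph_simps [simp]:
  "pverts (induced_graph G U) = U"
  "parcs (induced_graph G U) = Restr (parcs G) U"
  by (simp_all add: induced_graph_def)

lemma pair_graph_induced_graph:
  assumes "pair_graph G" "U \<subseteq> pverts G"
  shows "pair_graph (induced_graph G U)"
  using assms(1) finite_subset[OF assms(2)]
  unfolding pair_graph_iff by (auto simp: sym_def irrefl_def)

lemma subgraph_induced_graph:
  assumes "pair_graph G" "U \<subseteq> pverts G"
  shows "subgraph (with_proj (induced_graph G U)) (with_proj G)"
proof -
  interpret G: pair_graph G by fact
  interpret U: pair_graph "induced_graph G U" using assms by (rule pair_graph_induced_graph)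
  show ?thesis
    unfolding subgraph_def
    using assms(2) G.wf_digraph_axioms U.wf_digraph_axioms by (auto simp: compatibleI_with_proj)
qed

lemma quotient_graph_eq_contact_graph:
  assumes part: "\<And>P v. \<lbrakk>P \<in> \<P>; v \<in> P\<rbrakk> \<Longrightarrow> part v = P" and "{} \<notin> \<P>"
  shows "quotient_graph (induced_graph G (\<Union>\<P>)) part = contact_graph (parcs G) \<P>"
    (is "?Q = _")
proof (rule pair_pre_digraph.equality)
  have "P \<in> part ` \<Union>\<P>" if P: "P \<in> \<P>" for P
  proof -
    obtain v where "v \<in> P" using P assms(2) by fastforce
    then show ?thesis using part[OF P] P by blast
  qed
  then show "pverts ?Q = pverts (contact_graph (parcs G) \<P>)"
    using part by auto
  show "parcs ?Q = parcs (contact_graph (parcs G) \<P>)"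
  proof (intro equalityI subsetI)
    fix e assume "e \<in> parcs ?Q"
    then obtain a b where ab: "(a, b) \<in> Restr (parcs G) (\<Union>\<P>)" "e = (part a, part b)" "e \<notin> Id"
      by auto
    then obtain P Q where PQ: "P \<in> \<P>" "a \<in> P" "Q \<in> \<P>" "b \<in> Q" "(a, b) \<in> parcs G" by auto
    then have "e = (P, Q)" "touches (parcs G) P Q"
      using ab(2) part by (simp, unfold touches_def, blast)
    then show "e \<in> parcs (contact_graph (parcs G) \<P>)" using PQ ab(3) by simp
  next
    fix e assume "e \<in> parcs (contact_graph (parcs G) \<P>)"
    then obtain P Q where PQ: "e = (P, Q)" "P \<in> \<P>" "Q \<in> \<P>" "P \<noteq> Q" "touches (parcs G) P Q"
      by (cases e) simp
    then obtain a b where ab: "a \<in> P" "b \<in> Q" "(a, b) \<in> parcs G" unfolding touches_def by blast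
    then have "(a, b) \<in> Restr (parcs G) (\<Union>\<P>)" using PQ by blast
    moreover have "e = map_prod part part (a, b)" using ab PQ part by simp
    ultimately show "e \<in> parcs ?Q"
      using PQ(1,4) unfolding quotient_graph_simps induced_graph_simps by blast
  qed
qed simp

lemma minor_contact_graph:
  assumes "pair_graph G" "disjoint \<P>" "\<And>P. P \<in> \<P> \<Longrightarrow> connected_set (parcs G) P \<and> P \<subseteq> pverts G"
  shows "minor (contact_graph (parcs G) \<P>) G"
proof -
  define part where "part v = (THE P. P \<in> \<P> \<and> v \<in> P)" for v
  have part: "part v = P" if "P \<in> \<P>" "v \<in> P" for v P
    unfolding part_def using that disjointD[OF assms(2)] by (intro the_equality) blast+
  let ?G = "induced_graph G (\<Union>\<P>)"
  have Union: "\<Union>\<P> \<subseteq> pverts G" using assms(3) by blast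
  have "connected_fibres ?G part"
    unfolding connected_fibres_def
  proof
    fix v assume "v \<in> pverts ?G"
    then obtain P where P: "P \<in> \<P>" "v \<in> P" by auto
    have "connected_set (parcs ?G) P"
      by (rule connected_set_mono[of "parcs G"]) (use assms(3)[OF P(1)] P(1) in auto)
    moreover have "{w \<in> pverts ?G. part w = part v} = P" using P part by auto
    ultimately show "connected_set (parcs ?G) {w \<in> pverts ?G. part w = part v}" by simp
  qed
  then have "minor (quotient_graph ?G part) G"
    using assms(1) Union
    by (intro minor_quotient_graph pair_graph_induced_graph subgraph_induced_graph)
  moreover have "{} \<notin> \<P>" using assms(3) connected_set_nonempty by blast
  ultimately show ?thesis using quotient_graph_eq_contact_graph[of \<P> part G] part by simp
qed

lemma J_class_iff:
  "H \<in> J_class s t \<longleftrightarrow> pair_graph H \<and>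
     (\<exists>A B. A \<union> B = pverts H \<and> A \<inter> B = {} \<and> card A = s \<and> card B = t \<and>
        (\<forall>u\<in>A. \<forall>v\<in>A. u \<noteq> v \<longrightarrow> (u, v) \<in> parcs H) \<and> (\<forall>a\<in>A. \<forall>b\<in>B. (a, b) \<in> parcs H) \<and>
        connected_set (parcs H) B)"
proof (cases "pair_graph H")
  case True
  have "connected (with_proj H \<restriction> B) \<longleftrightarrow> connected_set (parcs H) B" if "A \<union> B = pverts H" for A B
    using that by (intro pair_graph.connected_induce_subgraph_iff[OF True]) blast
  then show ?thesis unfolding J_class_def using True by (simp cong: conj_cong)
qed (simp add: J_class_def)

lemma J_classI:
  assumes "pair_graph H" "A \<union> B = pverts H" "A \<inter> B = {}"
    and "\<And>u v. \<lbrakk>u \<in> A; v \<in> A; u \<noteq> v\<rbrakk> \<Longrightarrow> (u, v) \<in> parcs H"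
    and "\<And>a b. \<lbrakk>a \<in> A; b \<in> B\<rbrakk> \<Longrightarrow> (a, b) \<in> parcs H" and "connected_set (parcs H) B"
  shows "H \<in> J_class (card A) (card B)"
  unfolding J_class_iff
  by (rule conjI[OF assms(1)], rule exI[of _ A], rule exI[of _ B]) (use assms(2-6) in simp)

lemma J_class_quotient_graph:
  assumes "H \<in> J_class s t" "inj_on f (pverts H)"
  shows "quotient_graph H f \<in> J_class s t"
proof -
  obtain A B where "pair_graph H" and AB: "A \<union> B = pverts H" "A \<inter> B = {}"
    and card: "card A = s" "card B = t"
    and clique: "\<forall>u\<in>A. \<forall>v\<in>A. u \<noteq> v \<longrightarrow> (u, v) \<in> parcs H"
    and join: "\<forall>a\<in>A. \<forall>b\<in>B. (a, b) \<in> parcs H" and conn: "connected_set (parcs H) B"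
    using assms(1) unfolding J_class_iff by blast
  have inj: "inj_on f A" "inj_on f B" using assms(2) AB(1) by (auto intro: inj_on_subset)
  have "f ` A \<inter> f ` B = {}" using assms(2) AB inj_on_image_Int[of f "pverts H" A B] by auto
  moreover have "connected_set (parcs (quotient_graph H f)) (f ` B)"
    by (rule connected_set_image[OF conn]) force
  moreover have "(a, b) \<in> parcs (quotient_graph H f)"
    if "a \<in> f ` A" "b \<in> f ` A \<union> f ` B" "a \<noteq> b" for a b
    using that clique join by force
  ultimately have "quotient_graph H f \<in> J_class (card (f ` A)) (card (f ` B))"
    using pair_graph_quotient_graph[OF \<open>pair_graph H\<close>] AB(1)
    by (intro J_classI) (simp_all flip: AB(1) add: image_Un, blast+)
  then show ?thesis using card inj by (simp add: card_image)
qed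

lemma J_minor_freeD:
  assumes "J_minor_free s t G" "H \<in> J_class s t"
  shows "\<not> minor H G"
proof
  assume "minor H G"
  then obtain G0 G1 where G0: "pair_graph G0" "subgraph (with_proj G0) (with_proj G)"
      "edge_contraction\<^sup>*\<^sup>* G0 G1" and iso: "digraph_iso (with_proj G1) (with_proj H)"
    unfolding minor_def by blast
  have H: "pair_graph H" using assms(2) by (simp add: J_class_iff)
  then obtain f :: "_ \<Rightarrow> nat" where f: "inj_on f (pverts H)"
    using finite_imp_inj_to_nat_seg[OF pair_graph_finite] by metis
  have "digraph_iso (with_proj G1) (with_proj (quotient_graph H f))"
    using iso digraph_iso_quotient_graph[OF H f] by (rule digraph_iso_trans)
  then have "minor (quotient_graph H f) G" unfolding minor_def using G0 by blast
  then show False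
    using assms(1) J_class_quotient_graph[OF assms(2) f] unfolding J_minor_free_def by blast
qed

lemma contact_graph_in_J_class:
  assumes "sym E" "finite \<A>" "finite \<B>" "\<A> \<inter> \<B> = {}"
    and "pairwise (touches E) \<A>" "\<And>A B. \<lbrakk>A \<in> \<A>; B \<in> \<B>\<rbrakk> \<Longrightarrow> touches E A B"
    and "partition_on C \<B>" "connected_set E C"
  shows "contact_graph E (\<A> \<union> \<B>) \<in> J_class (card \<A>) (card \<B>)"
proof (rule J_classI)
  show "pair_graph (contact_graph E (\<A> \<union> \<B>))"
    using assms(1-3) by (intro pair_graph_contact_graph) simp_all
  show "connected_set (parcs (contact_graph E (\<A> \<union> \<B>))) \<B>"
    using assms(7,8) by (intro connected_set_contact_graph) simp_all
  show "(A, B) \<in> parcs (contact_graph E (\<A> \<union> \<B>))" if "A \<in> \<A>" "B \<in> \<A>" "A \<noteq> B" for A B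
    using that pairwiseD[OF assms(5)] by simp
  show "(A, B) \<in> parcs (contact_graph E (\<A> \<union> \<B>))" if "A \<in> \<A>" "B \<in> \<B>" for A B
    using that assms(4,6) by auto
qed (use assms(4) in simp_all)

section \<open>Hitting connected sets with few bags\<close>

lemma tree_decomposition_iff:
  "tree_decomposition G T W \<longleftrightarrow>
     graph_tree T \<and> (\<forall>x\<in>pverts T. W x \<subseteq> pverts G) \<and>
     (\<forall>v\<in>pverts G. connected_set (parcs T) {x \<in> pverts T. v \<in> W x}) \<and>
     (\<forall>(u, v)\<in>parcs G. \<exists>x\<in>pverts T. u \<in> W x \<and> v \<in> W x)"
proof (cases "graph_tree T")
  case True
  then interpret pair_graph T by (simp add: graph_tree_iff)
  have "connected (with_proj T \<restriction> {x \<in> pverts T. v \<in> W x}) \<longleftrightarrow>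
      connected_set (parcs T) {x \<in> pverts T. v \<in> W x}" for v
    by (rule connected_induce_subgraph_iff) blast
  then show ?thesis unfolding tree_decomposition_def by simp
qed (simp add: tree_decomposition_def)

definition has_packing :: "nat \<Rightarrow> 'a set set \<Rightarrow> bool" where
  "has_packing n \<F> \<longleftrightarrow> (\<exists>\<S>\<subseteq>\<F>. finite \<S> \<and> card \<S> = n \<and> disjoint \<S>)"

lemma has_packing_Suc:
  assumes "has_packing n \<G>" "\<G> \<subseteq> \<F>" "S \<in> \<F>" "S \<noteq> {}" "\<And>S'. S' \<in> \<G> \<Longrightarrow> S' \<inter> S = {}"
  shows "has_packing (Suc n) \<F>"
proof -
  obtain \<S> where \<S>: "\<S> \<subseteq> \<G>" "finite \<S>" "card \<S> = n" "disjoint \<S>"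
    using assms(1) unfolding has_packing_def by blast
  have disjnt: "S' \<inter> S = {}" if "S' \<in> \<S>" for S' using that \<S>(1) assms(5) by blast
  then have "S \<notin> \<S>" using assms(4) by blast
  then have "card (insert S \<S>) = Suc n" using \<S>(2,3) by simp
  moreover have "disjoint (insert S \<S>)"
    using \<S>(4) disjnt unfolding pairwise_insert disjnt_def by blast
  moreover have "insert S \<S> \<subseteq> \<F>" using \<S>(1) assms(2,3) by blast
  ultimately show ?thesis
    using \<S>(2) unfolding has_packing_def by (intro exI[of _ "insert S \<S>"]) simp
qed

text \<open>\<open>K\<close> serves as the branch set of a new part that separates \<open>D\<close> from the rest of \<open>C\<close>.\<close>

definition guarded :: "('a \<times> 'a) set \<Rightarrow> ('a set \<Rightarrow> bool) \<Rightarrow> 'a set \<Rightarrow> 'a set \<Rightarrow> bool" where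
  "guarded E Q C D \<longleftrightarrow> (\<exists>K\<subseteq>C - D. connected_set E K \<and> Q K \<and> E `` D \<inter> C \<subseteq> D \<union> K)"

locale decomposed_graph = rooted_tree T r for T :: "'b pair_pre_digraph" and r :: 'b +
  fixes G :: "'a pair_pre_digraph" and W :: "'b \<Rightarrow> 'a set"
  assumes graph: "pair_graph G" and decomposition: "tree_decomposition G T W"
begin

lemma connected_bags: "v \<in> pverts G \<Longrightarrow> connected_set (parcs T) {x \<in> pverts T. v \<in> W x}"
  using decomposition by (simp add: tree_decomposition_iff)

lemma edge_in_bag: "(u, v) \<in> parcs G \<Longrightarrow> \<exists>x\<in>pverts T. u \<in> W x \<and> v \<in> W x"
  using decomposition by (auto simp: tree_decomposition_iff)

lemmas finite_verts = pair_graph_finite[OF graph]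
  and sym_arcs = pair_graph_sym[OF graph]

lemma connected_trace:
  assumes "connected_set (parcs G) S" "S \<subseteq> pverts G"
  shows "connected_set (parcs T) {x \<in> pverts T. S \<inter> W x \<noteq> {}}"
proof -
  have "connected_set (parcs T) (\<Union>v\<in>S. {x \<in> pverts T. v \<in> W x})"
  proof (rule connected_set_UN[OF assms(1)])
    show "connected_set (parcs T) {x \<in> pverts T. v \<in> W x}" if "v \<in> S" for v
      using that assms(2) connected_bags by blast
  qed (use edge_in_bag in blast)
  also have "(\<Union>v\<in>S. {x \<in> pverts T. v \<in> W x}) = {x \<in> pverts T. S \<inter> W x \<noteq> {}}" by blast
  finally show ?thesis .
qed

definition bags_below :: "'b \<Rightarrow> 'a set" where
  "bags_below z = \<Union>(W ` descendants z)"

lemma verts_subset_bags_below_root: "pverts G \<subseteq> bags_below r"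
proof
  fix v assume "v \<in> pverts G"
  then have "{x \<in> pverts T. v \<in> W x} \<noteq> {}" by (rule connected_set_nonempty[OF connected_bags])
  then show "v \<in> bags_below r" unfolding bags_below_def descendants_root by blast
qed

lemma neighbour_in_bags_below:
  assumes "a \<in> pverts G" "a \<in> bags_below z" "a \<notin> W z" "(a, b) \<in> parcs G"
  shows "b \<in> bags_below z"
proof -
  have "{x \<in> pverts T. a \<in> W x} \<subseteq> descendants z"
    by (rule connected_set_subset_descendants[OF connected_bags[OF assms(1)]])
      (use assms(2,3) descendants_subset in \<open>auto simp: bags_below_def\<close>)
  then show ?thesis using edge_in_bag[OF assms(4)] unfolding bags_below_def by blast
qed

lemma avoiding_bag_descends:
  assumes "z \<in> pverts T" "connected_set (parcs G) S" "S \<subseteq> pverts G"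
    and "S \<inter> W z = {}" "S \<inter> bags_below z \<noteq> {}"
  obtains y where "y \<in> pverts T" "S \<subseteq> bags_below y" "descendants y \<subset> descendants z"
proof -
  let ?P = "{x \<in> pverts T. S \<inter> W x \<noteq> {}}"
  have P: "connected_set (parcs T) ?P" using assms(2,3) by (rule connected_trace)
  have Pz: "?P \<subseteq> pverts T - {z}" using assms(4) by blast
  have "?P \<inter> descendants z \<noteq> {}"
    using assms(5) descendants_subset unfolding bags_below_def by blast
  then have "?P \<subseteq> descendants z" by (rule connected_set_subset_descendants[OF P Pz])
  then have "?P \<subseteq> descendants z - {z}" using Pz by blast
  then obtain y where y: "y \<in> pverts T" "?P \<subseteq> descendants y" "descendants y \<subset> descendants z"
    by (rule connected_set_below_child[OF assms(1) P])
  have "S \<subseteq> bags_below y"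
  proof
    fix v assume v: "v \<in> S"
    then obtain x where "x \<in> pverts T" "v \<in> W x"
      using connected_set_nonempty[OF connected_bags[of v]] assms(3) by blast
    then show "v \<in> bags_below y" unfolding bags_below_def using y(2) v by blast
  qed
  then show thesis using that y(1,3) by blast
qed

lemma obtain_lowest_bag:
  assumes "\<And>S. S \<in> \<F> \<Longrightarrow> connected_set (parcs G) S \<and> S \<subseteq> pverts G" and "\<F> \<noteq> {}"
  obtains z S where "z \<in> pverts T" "S \<in> \<F>" "S \<subseteq> bags_below z"
    "\<And>S'. \<lbrakk>S' \<in> \<F>; S' \<inter> W z = {}\<rbrakk> \<Longrightarrow> S' \<inter> bags_below z = {}"
proof -
  let ?hosts = "\<lambda>z. z \<in> pverts T \<and> (\<exists>S\<in>\<F>. S \<subseteq> bags_below z)"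
  have "?hosts r" using root verts_subset_bags_below_root assms by blast
  then obtain z where z: "?hosts z"
    and least: "\<And>y. ?hosts y \<Longrightarrow> card (descendants z) \<le> card (descendants y)"
    using ex_has_least_nat[of ?hosts r "\<lambda>z. card (descendants z)"] by blast
  then obtain S where S: "S \<in> \<F>" "S \<subseteq> bags_below z" by blast
  have finite: "finite (descendants z)"
    using descendants_subset finite_nodes by (rule finite_subset)
  have "S' \<inter> bags_below z = {}" if S': "S' \<in> \<F>" "S' \<inter> W z = {}" for S'
  proof (rule ccontr)
    assume "S' \<inter> bags_below z \<noteq> {}"
    then obtain y where "y \<in> pverts T" "S' \<subseteq> bags_below y" "descendants y \<subset> descendants z"
      using avoiding_bag_descends[of z S'] z assms(1)[OF S'(1)] S'(2) by blast
    then show False using least[of y] S'(1) psubset_card_mono[OF finite] by (meson leD)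
  qed
  then show thesis using that z S by blast
qed

definition hit_by_fewer_bags :: "nat \<Rightarrow> 'a set set \<Rightarrow> bool" where
  "hit_by_fewer_bags n \<F> \<longleftrightarrow> (\<exists>M\<subseteq>pverts T. card M < n \<and> (\<forall>S\<in>\<F>. S \<inter> \<Union>(W ` M) \<noteq> {}))"

lemma hit_by_fewer_bags_Suc:
  assumes "hit_by_fewer_bags n {S \<in> \<F>. S \<inter> W z = {}}" "z \<in> pverts T"
  shows "hit_by_fewer_bags (Suc n) \<F>"
proof -
  obtain M where M: "M \<subseteq> pverts T" "card M < n" "\<forall>S\<in>{S \<in> \<F>. S \<inter> W z = {}}. S \<inter> \<Union>(W ` M) \<noteq> {}"
    using assms(1) unfolding hit_by_fewer_bags_def by blast
  have "card (insert z M) < Suc n"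
    using M(1,2) finite_subset[OF M(1) finite_nodes] by (simp add: card_insert_if)
  moreover have "\<forall>S\<in>\<F>. S \<inter> \<Union>(W ` insert z M) \<noteq> {}" using M(3) by blast
  ultimately show ?thesis
    using M(1) assms(2) unfolding hit_by_fewer_bags_def by (intro exI[of _ "insert z M"]) simp
qed

text \<open>The Erdos-Posa property of subtrees of a tree, transported to connected sets.\<close>

lemma has_packing_or_hit_by_fewer_bags:
  assumes "\<And>S. S \<in> \<F> \<Longrightarrow> connected_set (parcs G) S \<and> S \<subseteq> pverts G"
  shows "has_packing n \<F> \<or> hit_by_fewer_bags n \<F>"
  using assms
proof (induction n arbitrary: \<F>)
  case 0
  show ?case unfolding has_packing_def by (intro disjI1 exI[of _ "{}"]) simp
next
  case (Suc n)
  show ?case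
  proof (cases "\<F> = {}")
    case True
    then show ?thesis unfolding hit_by_fewer_bags_def by (intro disjI2 exI[of _ "{}"]) simp
  next
    case False
    obtain z S where z: "z \<in> pverts T" and S: "S \<in> \<F>" "S \<subseteq> bags_below z"
      and avoiding: "\<And>S'. \<lbrakk>S' \<in> \<F>; S' \<inter> W z = {}\<rbrakk> \<Longrightarrow> S' \<inter> bags_below z = {}"
      using obtain_lowest_bag[OF Suc.prems False] by blast
    let ?\<G> = "{S' \<in> \<F>. S' \<inter> W z = {}}"
    have "has_packing n ?\<G> \<or> hit_by_fewer_bags n ?\<G>"
      by (rule Suc.IH) (use Suc.prems in blast)
    then show ?thesis
    proof
      assume "has_packing n ?\<G>"
      moreover have "S \<noteq> {}" using Suc.prems[OF S(1)] connected_set_nonempty by blast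
      moreover have "S' \<inter> S = {}" if "S' \<in> ?\<G>" for S' using that avoiding[of S'] S(2) by blast
      ultimately show ?thesis using has_packing_Suc[of n ?\<G> \<F> S] S(1) by blast
    next
      assume "hit_by_fewer_bags n ?\<G>"
      then show ?thesis using hit_by_fewer_bags_Suc[OF _ z] by blast
    qed
  qed
qed

lemma component_Diff_bag_subset:
  assumes "C \<subseteq> pverts G" "K \<in> components (parcs G) (C \<inter> bags_below z)"
    and "D \<in> components (parcs G) (C - W z \<inter> K)" "D \<inter> K \<noteq> {}"
  shows "D \<subseteq> K - W z"
proof -
  have K: "K \<subseteq> C \<inter> bags_below z" and D: "D \<subseteq> C - W z \<inter> K"
    using assms(2,3) by (auto dest!: components_subset)
  have "D \<subseteq> K"
  proof (rule connected_set_subset_closed[OF components_connected[OF assms(3)]])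
    show "parcs G `` (K \<inter> D) \<inter> D \<subseteq> K"
    proof
      fix b assume "b \<in> parcs G `` (K \<inter> D) \<inter> D"
      then obtain a where a: "a \<in> K" "a \<in> D" "(a, b) \<in> parcs G" and b: "b \<in> D" by blast
      have "b \<in> bags_below z"
        by (rule neighbour_in_bags_below[OF _ _ _ a(3)]) (use a(1,2) assms(1) K D in blast)+
      then show "b \<in> K" using components_closed[OF assms(2)] D a b by blast
    qed
  qed (use assms(4) in blast)
  then show ?thesis using D by blast
qed

lemma guarding_subset_of_bag:
  assumes C: "connected_set (parcs G) C" "C \<subseteq> pverts G" "Q C"
    and mono: "\<And>S S'. \<lbrakk>Q S; S \<subseteq> S'\<rbrakk> \<Longrightarrow> Q S'"
  obtains z Y where "z \<in> pverts T" "Y \<subseteq> C \<inter> W z"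
    "\<forall>D\<in>components (parcs G) (C - Y). Q D \<longrightarrow> guarded (parcs G) Q C D"
proof -
  let ?\<F> = "{S. connected_set (parcs G) S \<and> S \<subseteq> C \<and> Q S}"
  obtain z S where z: "z \<in> pverts T" and S: "S \<in> ?\<F>" "S \<subseteq> bags_below z"
    and avoiding: "\<And>S'. \<lbrakk>S' \<in> ?\<F>; S' \<inter> W z = {}\<rbrakk> \<Longrightarrow> S' \<inter> bags_below z = {}"
    by (rule obtain_lowest_bag[of ?\<F>]) (use C in auto)
  obtain K where K: "K \<in> components (parcs G) (C \<inter> bags_below z)" "S \<subseteq> K"
    by (rule obtain_component_superset[OF sym_arcs, of S "C \<inter> bags_below z"]) (use S in auto)
  have QK: "Q K" using S(1) K(2) by (auto intro: mono)
  have "guarded (parcs G) Q C D" if D: "D \<in> components (parcs G) (C - W z \<inter> K)" and QD: "Q D" for D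
  proof -
    have "D \<inter> K = {}"
    proof (rule ccontr)
      assume "D \<inter> K \<noteq> {}"
      moreover from this have "D \<subseteq> K - W z" by (rule component_Diff_bag_subset[OF C(2) K(1) D])
      ultimately have "D \<inter> W z = {}" "D \<inter> bags_below z \<noteq> {}"
        using components_subset[OF K(1)] by blast+
      moreover have "D \<in> ?\<F>" using QD components_connected[OF D] components_subset[OF D] by blast
      ultimately show False using avoiding[of D] by blast
    qed
    moreover have "parcs G `` D \<inter> C \<subseteq> D \<union> K" using components_closed[OF D] by blast
    moreover have "K \<subseteq> C" using components_subset[OF K(1)] by blast
    ultimately show ?thesis
      unfolding guarded_def using components_connected[OF K(1)] QK by (intro exI[of _ K]) blast
  qed
  moreover have "W z \<inter> K \<subseteq> C \<inter> W z" using components_subset[OF K(1)] by blast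
  ultimately show thesis using that[OF z] by blast
qed

end

section \<open>Choosing a new part\<close>

definition attached :: "('a \<times> 'a) set \<Rightarrow> 'a set set \<Rightarrow> 'a set \<Rightarrow> 'a set set" where
  "attached E \<P> D = {P \<in> \<P>. touches E D P}"

definition colourful :: "('a \<times> 'a) set \<Rightarrow> 'a set set \<Rightarrow> 'a set \<Rightarrow> bool" where
  "colourful E N D \<longleftrightarrow> attached E N D = N"

lemma attached_subset: "attached E \<P> D \<subseteq> \<P>"
  by (auto simp: attached_def)

lemma attached_mono: "D \<subseteq> D' \<Longrightarrow> attached E \<P> D \<subseteq> attached E \<P> D'"
  unfolding attached_def using touches_mono by blast

lemma attached_Un: "attached E \<P> (D \<union> D') = attached E \<P> D \<union> attached E \<P> D'"
  by (auto simp: attached_def touches_def)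

lemma attached_insert:
  "attached E (insert Y \<P>) D = (if touches E D Y then {Y} else {}) \<union> attached E \<P> D"
  by (auto simp: attached_def)

lemma attached_attached: "D \<subseteq> C \<Longrightarrow> attached E (attached E \<P> C) D = attached E \<P> D"
  unfolding attached_def using touches_mono by blast

lemma colourful_mono: "colourful E N D \<Longrightarrow> D \<subseteq> D' \<Longrightarrow> colourful E N D'"
  unfolding colourful_def using attached_mono attached_subset by blast

lemma components_Diff_Diff:
  assumes "D \<in> components E (C - Y)" "Z \<in> components E (C - D)" "D' \<in> components E (C - (Y - Z))"
  shows "D' \<in> components E (C - Y) \<or> D' \<subseteq> D \<union> Z"
proof (cases "D' \<inter> (D \<union> Z) = {}")
  case True
  then have "D' \<in> components E (C - Y)"
    using components_connected[OF assms(3)] components_subset[OF assms(3)]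
      components_closed[OF assms(3)]
    unfolding components_def by blast
  then show ?thesis ..
next
  case False
  have "D' \<subseteq> D \<union> Z"
    by (rule connected_set_subset_closed[OF components_connected[OF assms(3)]])
      (use False components_subset[OF assms(3)] components_closed[OF assms(1)]
        components_closed[OF assms(2)] in blast)+
  then show ?thesis ..
qed

text \<open>
  A component \<open>Z\<close> of \<open>C - D\<close> with no attachment beyond those of \<open>D\<close> may be removed from the
  separator: only subsets of \<open>D \<union> Z\<close> change, and they are no more colourful than \<open>D\<close>.
\<close>

lemma separator_remove_component:
  assumes "D \<in> components E (C - Y)" "\<not> colourful E N D"
    and "Z \<in> components E (C - D)" "attached E N Z \<subseteq> attached E N D"
    and good: "\<forall>D\<in>components E (C - Y). colourful E N D \<longrightarrow> good D"
    and D': "D' \<in> components E (C - (Y - Z))" "colourful E N D'"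
  shows "good D'"
proof -
  consider (old) "D' \<in> components E (C - Y)" | (merged) "D' \<subseteq> D \<union> Z"
    using components_Diff_Diff[OF assms(1,3) D'(1)] by blast
  then show ?thesis
  proof cases
    case old
    then show ?thesis using D'(2) good by blast
  next
    case merged
    then have "colourful E N (D \<union> Z)" by (rule colourful_mono[OF D'(2)])
    then have "colourful E N D"
      using assms(4) unfolding colourful_def attached_Un by blast
    then show ?thesis using assms(2) by blast
  qed
qed

lemma obtain_minimal_separator:
  assumes E: "sym E" and C: "connected_set E C" "finite C" "colourful E N C"
    and Y0: "Y0 \<subseteq> C" "\<forall>D\<in>components E (C - Y0). colourful E N D \<longrightarrow> good D"
    and "\<not> good C"
  obtains Y where "Y \<subseteq> Y0" "Y \<noteq> {}"
    "\<forall>D\<in>components E (C - Y). colourful E N D \<longrightarrow> good D"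
    "\<forall>D\<in>components E (C - Y). \<not> colourful E N D \<longrightarrow>
       (\<forall>Z\<in>components E (C - D). \<not> attached E N Z \<subseteq> attached E N D)"
proof -
  let ?separates = "\<lambda>Y. Y \<subseteq> Y0 \<and> (\<forall>D\<in>components E (C - Y). colourful E N D \<longrightarrow> good D)"
  have "?separates Y0" using Y0(2) by simp
  then obtain Y where Y: "?separates Y" and least: "\<And>Y'. ?separates Y' \<Longrightarrow> card Y \<le> card Y'"
    using ex_has_least_nat[of ?separates Y0 card] by blast
  have "Y \<noteq> {}"
  proof
    assume "Y = {}"
    then have "C \<in> components E (C - Y)" using C(1) by (simp add: components_def)
    then show False using Y C(3) assms(7) by blast
  qed
  moreover have "\<not> attached E N Z \<subseteq> attached E N D"
    if D: "D \<in> components E (C - Y)" "\<not> colourful E N D" and Z: "Z \<in> components E (C - D)" for D Z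
  proof
    assume sub: "attached E N Z \<subseteq> attached E N D"
    have "good D'" if "D' \<in> components E (C - (Y - Z))" "colourful E N D'" for D'
      using separator_remove_component[OF D Z sub _ that] Y by blast
    then have "card Y \<le> card (Y - Z)" using Y by (intro least) blast
    have "C - D \<subset> C" using components_nonempty[OF D(1)] components_subset[OF D(1)] by blast
    then have "touches E Z (C - (C - D))" using Z by (rule component_touches_Diff[OF C(1)])
    then have "touches E D Z" using touches_commute[OF E] touches_mono by blast
    then obtain a b where ab: "a \<in> D" "b \<in> Z" "(a, b) \<in> E" unfolding touches_def by blast
    have "b \<in> Y" using ab components_closed[OF D(1)] components_subset[OF Z] by blast
    then have "Y - Z \<subset> Y" using ab(2) by blast
    moreover have "finite Y" using Y Y0(1) C(2) by (meson finite_subset)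
    ultimately show False using psubset_card_mono \<open>card Y \<le> card (Y - Z)\<close> by (meson leD)
  qed
  ultimately show thesis using that[of Y] Y by blast
qed

text \<open>
  The parts \<open>N\<close> around \<open>D\<close> need be neither connected nor pairwise adjacent; the sets \<open>R P\<close> stand in
  for them as branch sets of a clique outside \<open>D\<close>.
\<close>

definition rooted_model ::
  "('a \<times> 'a) set \<Rightarrow> 'a set \<Rightarrow> 'a set \<Rightarrow> 'a set set \<Rightarrow> ('a set \<Rightarrow> 'a set) \<Rightarrow> bool" where
  "rooted_model E V D N R \<longleftrightarrow>
     (\<forall>P\<in>N. connected_set E (R P) \<and> R P \<subseteq> V - D \<and> E `` D \<inter> P \<subseteq> R P) \<and>
     pairwise (\<lambda>P Q. R P \<inter> R Q = {} \<and> touches E (R P) (R Q)) N"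

lemma rooted_modelD:
  assumes "rooted_model E V D N R" "P \<in> N"
  shows "connected_set E (R P)" "R P \<subseteq> V - D" "E `` D \<inter> P \<subseteq> R P"
    "\<And>Q. \<lbrakk>Q \<in> N; P \<noteq> Q\<rbrakk> \<Longrightarrow> R P \<inter> R Q = {} \<and> touches E (R P) (R Q)"
  using assms unfolding rooted_model_def pairwise_def by auto

lemma rooted_model_inj_on_disjoint:
  assumes "rooted_model E V D N R"
  shows "inj_on R N" "disjoint (R ` N)"
proof -
  have "disjoint_family_on R N"
    using rooted_modelD(4)[OF assms] unfolding disjoint_family_on_def by blast
  moreover have "R P \<noteq> {}" if "P \<in> N" for P
    using rooted_modelD(1)[OF assms that] by (rule connected_set_nonempty)
  ultimately show "inj_on R N" "disjoint (R ` N)"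
    using disjoint_family_on_iff_disjoint_image by blast+
qed

lemma rooted_model_mono:
  assumes "rooted_model E V D N R" "N' \<subseteq> N" "D' \<subseteq> D"
  shows "rooted_model E V D' N' R"
proof -
  have "connected_set E (R P) \<and> R P \<subseteq> V - D' \<and> E `` D' \<inter> P \<subseteq> R P" if "P \<in> N'" for P
    using rooted_modelD(1-3)[OF assms(1), of P] that assms(2,3) by blast
  then show ?thesis
    using assms(1,2) unfolding rooted_model_def by (auto intro: pairwise_subset)
qed

lemma rooted_model_touches:
  assumes "rooted_model E V D N R" "S \<subseteq> D" "P \<in> attached E N S"
  shows "touches E S (R P)"
  using rooted_modelD(3)[OF assms(1), of P] assms(2,3) unfolding attached_def touches_def by blast

lemma rooted_model_insert:
  assumes "sym E" "rooted_model E V D N R" "Y \<notin> N"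
    and K: "connected_set E K" "K \<subseteq> V - D" "E `` D \<inter> Y \<subseteq> K"
    and KR: "\<And>P. P \<in> N \<Longrightarrow> K \<inter> R P = {} \<and> touches E K (R P)"
  shows "rooted_model E V D (insert Y N) (R(Y := K))"
proof -
  have old: "(R(Y := K)) P = R P" if "P \<in> N" for P using that assms(3) by auto
  have RK: "R P \<inter> K = {} \<and> touches E (R P) K" if "P \<in> N" for P
    using KR[OF that] touches_commute[OF assms(1)] by blast
  have "pairwise (\<lambda>P Q. R P \<inter> R Q = {} \<and> touches E (R P) (R Q)) N"
    using assms(2) unfolding rooted_model_def by blast
  then have "pairwise (\<lambda>P Q. (R(Y := K)) P \<inter> (R(Y := K)) Q = {} \<and>
      touches E ((R(Y := K)) P) ((R(Y := K)) Q)) (insert Y N)"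
    using KR RK assms(3) unfolding pairwise_insert by (auto simp: pairwise_def)
  then show ?thesis
    using assms(2) K old unfolding rooted_model_def by simp
qed

lemma guarded_imp_rooted_model:
  assumes "sym E" "rooted_model E V C N R" "C \<subseteq> V" "D \<subseteq> C" "Y \<subseteq> C - D" "Y \<notin> N"
    and "guarded E (colourful E N) C D"
  shows "\<exists>R'. rooted_model E V D (insert Y N) R'"
proof -
  obtain K where K: "K \<subseteq> C - D" "connected_set E K" "colourful E N K" "E `` D \<inter> C \<subseteq> D \<union> K"
    using assms(7) unfolding guarded_def by blast
  have "rooted_model E V D (insert Y N) (R(Y := K))"
  proof (rule rooted_model_insert[OF assms(1) _ assms(6) K(2)])
    show "rooted_model E V D N R" by (rule rooted_model_mono[OF assms(2) subset_refl assms(4)])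
    show "K \<subseteq> V - D" "E `` D \<inter> Y \<subseteq> K" using K(1,4) assms(3,5) by blast+
    fix P assume P: "P \<in> N"
    have "K \<subseteq> C" using K(1) by blast
    moreover have "P \<in> attached E N K" using K(3) P by (simp add: colourful_def)
    ultimately have "touches E K (R P)" by (rule rooted_model_touches[OF assms(2)])
    then show "K \<inter> R P = {} \<and> touches E K (R P)"
      using rooted_modelD(2)[OF assms(2) P] K(1) by blast
  qed
  then show ?thesis by blast
qed

lemma connected_set_Un_branch_sets:
  assumes "sym E" "rooted_model E V C N R" "J \<subseteq> N" "J \<noteq> {}" "U \<subseteq> C"
    and "\<And>Z. Z \<in> components E U \<Longrightarrow> attached E N Z \<inter> J \<noteq> {}"
  shows "connected_set E (U \<union> \<Union>(R ` J))"
proof (rule connected_set_Un_components[OF assms(1)])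
  show "connected_set E (\<Union>(R ` J))"
    using assms(3,4) rooted_modelD(1,4)[OF assms(2)]
    by (intro connected_set_UN_pairwise pairwiseI) blast+
  show "touches E Z (\<Union>(R ` J))" if Z: "Z \<in> components E U" for Z
  proof -
    obtain P where P: "P \<in> attached E N Z" "P \<in> J" using assms(6)[OF Z] by blast
    have "Z \<subseteq> C" using components_subset[OF Z] assms(5) by blast
    then have "touches E Z (R P)" using P(1) by (rule rooted_model_touches[OF assms(2)])
    then show ?thesis using P(2) by (blast intro: touches_mono)
  qed
qed

text \<open>The parts not attached to \<open>D\<close> link all of \<open>C - D\<close> to the remaining parts.\<close>

lemma not_colourful_imp_rooted_model:
  assumes "sym E" "rooted_model E V C N R" "C \<subseteq> V" "D \<subseteq> C" "Y \<subseteq> C - D" "Y \<notin> N"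
    and "\<not> colourful E N D"
    and "\<forall>Z\<in>components E (C - D). \<not> attached E N Z \<subseteq> attached E N D"
  shows "\<exists>R'. rooted_model E V D (insert Y (attached E N D)) R'"
proof -
  define J where "J = N - attached E N D"
  define K where "K = (C - D) \<union> \<Union>(R ` J)"
  obtain Q where Q: "Q \<in> J"
    using assms(7) attached_subset unfolding J_def colourful_def by blast
  have "rooted_model E V D (insert Y (attached E N D)) (R(Y := K))"
  proof (rule rooted_model_insert[OF assms(1)])
    show "rooted_model E V D (attached E N D) R"
      using assms(2) attached_subset assms(4) by (rule rooted_model_mono)
    show "Y \<notin> attached E N D" using assms(6) attached_subset by blast
    have "attached E N Z \<inter> J \<noteq> {}" if "Z \<in> components E (C - D)" for Z
      using assms(8) that attached_subset unfolding J_def by blast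
    then show "connected_set E K"
      unfolding K_def using Q J_def by (intro connected_set_Un_branch_sets[OF assms(1,2)]) blast+
    show "K \<subseteq> V - D"
      using assms(3,4) rooted_modelD(2)[OF assms(2)] unfolding K_def J_def by blast
    show "E `` D \<inter> Y \<subseteq> K" using assms(5) unfolding K_def by blast
    fix P assume "P \<in> attached E N D"
    then have P: "P \<in> N" "P \<notin> J" using attached_subset unfolding J_def by blast+
    then have "R P \<inter> R P' = {} \<and> touches E (R P') (R P)" if "P' \<in> J" for P'
      using rooted_modelD(4)[OF assms(2), of P' P] that unfolding J_def by blast
    moreover have "R P \<inter> C = {}" using rooted_modelD(2)[OF assms(2) P(1)] by blast
    ultimately show "K \<inter> R P = {} \<and> touches E K (R P)"
      using Q unfolding K_def by (blast intro: touches_mono)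
  qed
  then show ?thesis by blast
qed

lemma colourful_partition_not_J_minor_free:
  assumes G: "pair_graph G" and N: "finite N" and C: "connected_set (parcs G) C" "C \<subseteq> pverts G"
    and R: "rooted_model (parcs G) (pverts G) C N R"
    and \<B>: "connected_packing (parcs G) C \<B>" "\<Union>\<B> = C" "\<forall>B\<in>\<B>. colourful (parcs G) N B"
  shows "\<not> J_minor_free (card N) (card \<B>) G"
proof -
  let ?E = "parcs G"
  have E: "sym ?E" using G by (rule pair_graph_sym)
  have fin: "finite \<B>" and disj: "disjoint \<B>" and conn: "\<And>B. B \<in> \<B> \<Longrightarrow> connected_set ?E B \<and> B \<subseteq> C"
    using \<B>(1) by (auto simp: connected_packing_def)
  then have part: "partition_on C \<B>"
    using \<B>(2) connected_set_nonempty unfolding partition_on_def by blast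
  have RC: "\<Union>(R ` N) \<inter> \<Union>\<B> = {}" using rooted_modelD(2)[OF R] \<B>(2) by blast
  have "contact_graph ?E (R ` N \<union> \<B>) \<in> J_class (card (R ` N)) (card \<B>)"
  proof (rule contact_graph_in_J_class[OF E _ fin _ _ _ part C(1)])
    show "R ` N \<inter> \<B> = {}"
    proof (rule ccontr)
      assume "R ` N \<inter> \<B> \<noteq> {}"
      then obtain B where B: "B \<in> R ` N" "B \<in> \<B>" by blast
      then have "B = {}" using RC by blast
      then show False using B(2) partition_onD3[OF part] by simp
    qed
    show "pairwise (touches ?E) (R ` N)"
      by (rule pairwise_imageI) (use rooted_modelD(4)[OF R] in blast)
    show "touches ?E A B" if "A \<in> R ` N" "B \<in> \<B>" for A B
    proof -
      have "touches ?E B A"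
        using that conn \<B>(3) rooted_model_touches[OF R, of B] unfolding colourful_def by blast
      then show ?thesis using touches_commute[OF E] by blast
    qed
  qed (use N in simp)
  moreover have "minor (contact_graph ?E (R ` N \<union> \<B>)) G"
  proof (rule minor_contact_graph[OF G])
    show "disjoint (R ` N \<union> \<B>)"
      using rooted_model_inj_on_disjoint(2)[OF R] disj RC by (rule disjoint_union)
    show "connected_set ?E P \<and> P \<subseteq> pverts G" if "P \<in> R ` N \<union> \<B>" for P
      using that rooted_modelD(1,2)[OF R] conn C(2) by blast
  qed
  ultimately show ?thesis
    using J_minor_freeD card_image[OF rooted_model_inj_on_disjoint(1)[OF R]] by metis
qed

lemma colourful_packing_not_J_minor_free:
  assumes "pair_graph G" "finite N" and C: "connected_set (parcs G) C" "C \<subseteq> pverts G"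
    and "rooted_model (parcs G) (pverts G) C N R"
    and \<S>: "connected_packing (parcs G) C \<S>" "\<S> \<noteq> {}" "\<forall>S\<in>\<S>. colourful (parcs G) N S"
  shows "\<not> J_minor_free (card N) (card \<S>) G"
proof -
  have "finite C" using C(2) pair_graph_finite[OF assms(1)] by (rule finite_subset)
  then obtain \<B> where \<B>: "connected_packing (parcs G) C \<B>" "\<Union>\<B> = C" "card \<B> = card \<S>"
      "\<forall>B\<in>\<B>. \<exists>S\<in>\<S>. S \<subseteq> B"
    using connected_packing_extend_to_partition[OF pair_graph_sym[OF assms(1)] C(1) _ \<S>(1,2)]
    by blast
  have "\<forall>B\<in>\<B>. colourful (parcs G) N B" using \<B>(4) \<S>(3) colourful_mono by blast
  then show ?thesis
    using colourful_partition_not_J_minor_free[OF assms(1-5) \<B>(1,2)] \<B>(3) by simp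
qed

text \<open>
  Here \<open>C\<close> is a component of the vertices not yet covered, \<open>N\<close> the set of parts attached to it and
  \<open>Y\<close> the part to be added.
\<close>

definition valid_part :: "('a \<times> 'a) set \<Rightarrow> 'a set \<Rightarrow> nat \<Rightarrow> 'a set set \<Rightarrow> 'a set \<Rightarrow> 'a set \<Rightarrow> bool" where
  "valid_part E V s N C Y \<longleftrightarrow> Y \<noteq> {} \<and> Y \<subseteq> C \<and>
     (\<forall>D\<in>components E (C - Y). card (attached E N D) < s \<and>
        (\<exists>R. rooted_model E V D (insert Y (attached E N D)) R))"

lemma valid_partI:
  assumes "sym E" "rooted_model E V C N R" "C \<subseteq> V" "finite N" "card N \<le> s" "\<Union>N \<inter> C = {}"
    and Y: "Y \<noteq> {}" "Y \<subseteq> C"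
    and guards: "\<forall>D\<in>components E (C - Y). colourful E N D \<longrightarrow>
      card N < s \<and> guarded E (colourful E N) C D"
    and gains: "\<forall>D\<in>components E (C - Y). \<not> colourful E N D \<longrightarrow>
      (\<forall>Z\<in>components E (C - D). \<not> attached E N Z \<subseteq> attached E N D)"
  shows "valid_part E V s N C Y"
  unfolding valid_part_def
proof (intro conjI ballI)
  have "Y \<notin> N" using Y assms(6) by blast
  fix D assume D: "D \<in> components E (C - Y)"
  have D_sub: "D \<subseteq> C" "Y \<subseteq> C - D" using components_subset[OF D] Y(2) by blast+
  show "card (attached E N D) < s"
  proof (cases "colourful E N D")
    case True
    then show ?thesis using guards D by (simp add: colourful_def)
  next
    case False
    then have "attached E N D \<subset> N" using attached_subset unfolding colourful_def by blast
    then show ?thesis using psubset_card_mono[OF assms(4)] assms(5) by (meson less_le_trans)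
  qed
  show "\<exists>R. rooted_model E V D (insert Y (attached E N D)) R"
  proof (cases "colourful E N D")
    case True
    then have "attached E N D = N" by (simp add: colourful_def)
    then show ?thesis
      using guards D True guarded_imp_rooted_model[OF assms(1-3) D_sub \<open>Y \<notin> N\<close>] by simp
  next
    case False
    then show ?thesis
      using gains D not_colourful_imp_rooted_model[OF assms(1-3) D_sub \<open>Y \<notin> N\<close>] by simp
  qed
qed (use Y in simp_all)

context decomposed_graph
begin

definition covered_by_bags :: "nat \<Rightarrow> 'a set \<Rightarrow> bool" where
  "covered_by_bags k S \<longleftrightarrow> (\<exists>M\<subseteq>pverts T. card M \<le> k \<and> S \<subseteq> \<Union>(W ` M))"

lemma covered_by_bags_subset: "covered_by_bags k S \<Longrightarrow> S' \<subseteq> S \<Longrightarrow> covered_by_bags k S'"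
  unfolding covered_by_bags_def by (meson subset_trans)

lemma J_minor_free_imp_few_bags_hit_colourful:
  assumes free: "J_minor_free (card N) t G" and "0 < t" and N: "finite N"
    and C: "connected_set (parcs G) C" "C \<subseteq> pverts G"
    and R: "rooted_model (parcs G) (pverts G) C N R"
  obtains Y where "Y \<subseteq> C" "covered_by_bags (t - 1) Y"
    "\<forall>D\<in>components (parcs G) (C - Y). \<not> colourful (parcs G) N D"
proof -
  let ?\<F> = "{S. connected_set (parcs G) S \<and> S \<subseteq> C \<and> colourful (parcs G) N S}"
  have "\<not> has_packing t ?\<F>"
  proof
    assume "has_packing t ?\<F>"
    then obtain \<S> where \<S>: "\<S> \<subseteq> ?\<F>" "finite \<S>" "card \<S> = t" "disjoint \<S>"
      unfolding has_packing_def by blast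
    then have "connected_packing (parcs G) C \<S>" "\<S> \<noteq> {}" "\<forall>S\<in>\<S>. colourful (parcs G) N S"
      using assms(2) unfolding connected_packing_def by auto
    then show False
      using colourful_packing_not_J_minor_free[OF graph N C R] free \<S>(3) by blast
  qed
  moreover have "has_packing t ?\<F> \<or> hit_by_fewer_bags t ?\<F>"
    by (rule has_packing_or_hit_by_fewer_bags) (use C(2) in blast)
  ultimately obtain M where M: "M \<subseteq> pverts T" "card M < t" "\<forall>S\<in>?\<F>. S \<inter> \<Union>(W ` M) \<noteq> {}"
    unfolding hit_by_fewer_bags_def by blast
  show thesis
  proof (rule that)
    show "C \<inter> \<Union>(W ` M) \<subseteq> C" by blast
    show "covered_by_bags (t - 1) (C \<inter> \<Union>(W ` M))"
      unfolding covered_by_bags_def using M(1,2) by (intro exI[of _ M]) auto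
    show "\<forall>D\<in>components (parcs G) (C - C \<inter> \<Union>(W ` M)). \<not> colourful (parcs G) N D"
    proof
      fix D assume D: "D \<in> components (parcs G) (C - C \<inter> \<Union>(W ` M))"
      show "\<not> colourful (parcs G) N D"
        using M(3) components_connected[OF D] components_subset[OF D] by blast
    qed
  qed
qed

lemma obtain_guarding_separator:
  assumes "J_minor_free s t G" "2 \<le> t" "connected_set (parcs G) C" "C \<subseteq> pverts G"
    and "finite N" "card N \<le> s" "colourful (parcs G) N C"
    and "rooted_model (parcs G) (pverts G) C N R"
  obtains Y where "Y \<subseteq> C" "covered_by_bags (t - 1) Y"
    "\<forall>D\<in>components (parcs G) (C - Y). colourful (parcs G) N D \<longrightarrow>
       card N < s \<and> guarded (parcs G) (colourful (parcs G) N) C D"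
proof (cases "card N < s")
  case True
  obtain z Y where "z \<in> pverts T" "Y \<subseteq> C \<inter> W z"
    and "\<forall>D\<in>components (parcs G) (C - Y). colourful (parcs G) N D \<longrightarrow>
       guarded (parcs G) (colourful (parcs G) N) C D"
    by (rule guarding_subset_of_bag[where Q = "colourful (parcs G) N",
          OF assms(3,4,7) colourful_mono])
  moreover from this have "covered_by_bags (t - 1) Y"
    unfolding covered_by_bags_def using assms(2) by (intro exI[of _ "{z}"]) auto
  ultimately show thesis using that[of Y] True by blast
next
  case False
  then have "J_minor_free (card N) t G" using assms(1,6) by simp
  moreover have "0 < t" using assms(2) by simp
  ultimately obtain Y where "Y \<subseteq> C" "covered_by_bags (t - 1) Y"
    "\<forall>D\<in>components (parcs G) (C - Y). \<not> colourful (parcs G) N D"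
    by (rule J_minor_free_imp_few_bags_hit_colourful[OF _ _ assms(5,3,4,8)])
  then show thesis using that[of Y] by blast
qed

lemma obtain_new_part:
  assumes "J_minor_free s t G" "2 \<le> t" and C: "connected_set (parcs G) C" "C \<subseteq> pverts G"
    and N: "finite N" "card N \<le> s" "colourful (parcs G) N C" "\<Union>N \<inter> C = {}"
    and R: "rooted_model (parcs G) (pverts G) C N R"
  obtains Y where "valid_part (parcs G) (pverts G) s N C Y" "covered_by_bags (t - 1) Y"
proof -
  let ?E = "parcs G"
  obtain Y0 where Y0: "Y0 \<subseteq> C" "covered_by_bags (t - 1) Y0"
    "\<forall>D\<in>components ?E (C - Y0). colourful ?E N D \<longrightarrow> card N < s \<and> guarded ?E (colourful ?E N) C D"
    by (rule obtain_guarding_separator[OF assms(1,2) C N(1-3) R])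
  have "finite C" using C(2) finite_verts by (rule finite_subset)
  have "\<not> (card N < s \<and> guarded ?E (colourful ?E N) C C)"
    using connected_set_nonempty unfolding guarded_def by blast
  with Y0(1,3) obtain Y where Y: "Y \<subseteq> Y0" "Y \<noteq> {}"
    and guards: "\<forall>D\<in>components ?E (C - Y). colourful ?E N D \<longrightarrow>
      card N < s \<and> guarded ?E (colourful ?E N) C D"
    and gains: "\<forall>D\<in>components ?E (C - Y). \<not> colourful ?E N D \<longrightarrow>
      (\<forall>Z\<in>components ?E (C - D). \<not> attached ?E N Z \<subseteq> attached ?E N D)"
    by (rule obtain_minimal_separator[OF sym_arcs C(1) \<open>finite C\<close> N(3)])
  have "Y \<subseteq> C" using Y(1) Y0(1) by blast
  then have "valid_part ?E (pverts G) s N C Y"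
    using valid_partI[OF sym_arcs R C(2) N(1,2,4) Y(2)] guards gains by blast
  moreover have "covered_by_bags (t - 1) Y" using Y0(2) Y(1) by (rule covered_by_bags_subset)
  ultimately show thesis by (rule that)
qed

end

section \<open>Building the partition\<close>

lemma connected_nodes_add_leaf:
  assumes "sym (parcs T)" "connected_set (parcs T) {y \<in> pverts T. v \<in> B y}"
    and "x \<in> pverts T" "v \<in> L \<Longrightarrow> v \<in> B x" "l \<notin> pverts T"
  shows "connected_set (parcs (add_leaf T x l)) {y \<in> pverts (add_leaf T x l). v \<in> (B(l := L)) y}"
proof -
  let ?S = "{y \<in> pverts T. v \<in> B y}"
  have "connected_set (parcs (add_leaf T x l)) ?S"
    by (rule connected_set_mono[OF assms(2)]) auto
  moreover have "connected_set (parcs (add_leaf T x l)) (insert l ?S)" if "v \<in> L"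
    using assms(1-4) that by (intro connected_set_insert_leaf) auto
  moreover have "{y \<in> pverts (add_leaf T x l). v \<in> (B(l := L)) y} =
      (if v \<in> L then insert l ?S else ?S)"
    using assms(5) by auto
  ultimately show ?thesis by simp
qed

lemma tree_decomposition_add_leaf:
  assumes H: "tree_decomposition H T B" and x: "x \<in> pverts T" "N \<subseteq> B x" and l: "l \<notin> pverts T"
    and Y: "Y \<notin> pverts H" "pverts H' = insert Y (pverts H)"
      "parcs H' \<subseteq> parcs H \<union> {Y} \<times> N \<union> N \<times> {Y}"
  shows "tree_decomposition H' (add_leaf T x l) (B(l := insert Y N))"
  unfolding tree_decomposition_iff
proof (intro conjI ballI)
  let ?T = "add_leaf T x l" and ?B = "B(l := insert Y N)"
  have tree: "graph_tree T" and bags: "\<And>y. y \<in> pverts T \<Longrightarrow> B y \<subseteq> pverts H"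
    and conn: "\<And>v. v \<in> pverts H \<Longrightarrow> connected_set (parcs T) {y \<in> pverts T. v \<in> B y}"
    and edges: "\<And>u v. (u, v) \<in> parcs H \<Longrightarrow> \<exists>y\<in>pverts T. u \<in> B y \<and> v \<in> B y"
    using H by (auto simp: tree_decomposition_iff)
  show "graph_tree ?T" using tree x(1) l by (rule graph_tree_add_leaf)
  show "?B y \<subseteq> pverts H'" if "y \<in> pverts ?T" for y
    using that bags[of y] bags[OF x(1)] x(2) Y(2) by auto
  show "connected_set (parcs ?T) {y \<in> pverts ?T. v \<in> ?B y}" if v: "v \<in> pverts H'" for v
  proof (cases "v = Y")
    case True
    then have "{y \<in> pverts ?T. v \<in> ?B y} = {l}" using bags Y(1) by auto
    then show ?thesis by (simp add: connected_set_singleton)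
  next
    case False
    then have "connected_set (parcs T) {y \<in> pverts T. v \<in> B y}" using v Y(2) by (intro conn) simp
    moreover have "sym (parcs T)" using tree by (simp add: graph_tree_iff pair_graph_sym)
    ultimately show ?thesis using x l False by (intro connected_nodes_add_leaf) auto
  qed
  fix e assume "e \<in> parcs H'"
  then consider (old) "e \<in> parcs H" | (new) "e \<in> insert Y N \<times> insert Y N" using Y(3) by blast
  then show "case e of (u, v) \<Rightarrow> \<exists>y\<in>pverts ?T. u \<in> ?B y \<and> v \<in> ?B y"
  proof cases
    case old
    then obtain y where "y \<in> pverts T" "fst e \<in> B y" "snd e \<in> B y" using edges by (cases e) auto
    then show ?thesis using l by (auto simp: case_prod_beta intro!: bexI[of _ y])
  next
    case new
    then show ?thesis by (auto simp: case_prod_beta)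
  qed
qed

lemma tree_decomposition_contact_graph_insert:
  assumes "sym E" "tree_decomposition (contact_graph E \<P>) T B"
    and "x \<in> pverts T" "attached E \<P> Y \<subseteq> N" "N \<subseteq> B x" "l \<notin> pverts T" "Y \<notin> \<P>"
  shows "tree_decomposition (contact_graph E (insert Y \<P>)) (add_leaf T x l) (B(l := insert Y N))"
proof (rule tree_decomposition_add_leaf[OF assms(2,3,5,6)])
  have "P \<in> attached E \<P> Y" if "P \<in> \<P>" "touches E P Y \<or> touches E Y P" for P
    using that touches_commute[OF assms(1), of P Y] unfolding attached_def by blast
  then show "parcs (contact_graph E (insert Y \<P>)) \<subseteq> parcs (contact_graph E \<P>) \<union> {Y} \<times> N \<union> N \<times> {Y}"
    using assms(4) unfolding contact_graph_simps by blast
qed (use assms(7) in simp_all)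

lemma graph_partition_contact_graph:
  assumes "pair_graph G" "partition_on (pverts G) \<P>"
  shows "graph_partition G (contact_graph (parcs G) \<P>)"
proof -
  have "finite \<P>" using pair_graph_finite[OF assms(1)] assms(2) by (rule finite_elements)
  then have "pair_graph (contact_graph (parcs G) \<P>)"
    using pair_graph_sym[OF assms(1)] by (rule pair_graph_contact_graph)
  moreover have "\<exists>!X. X \<in> \<P> \<and> v \<in> X" if "v \<in> pverts G" for v
    using that partition_onD1[OF assms(2)] disjointD[OF partition_onD2[OF assms(2)]] by blast
  ultimately show ?thesis
    unfolding graph_partition_def touches_def contact_graph_simps
    using partition_onD1[OF assms(2)] by auto
qed

lemma partition_bag_width_le:
  assumes "finite (pverts H)" "\<And>P. P \<in> pverts H \<Longrightarrow> set_bag_width T W P \<le> k"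
  shows "partition_bag_width T W H \<le> k"
  using assms by (auto simp: partition_bag_width_def)

lemma treewidth_le:
  fixes T :: "nat pair_pre_digraph"
  assumes "tree_decomposition H T B" "\<And>x. x \<in> pverts T \<Longrightarrow> card (B x) \<le> Suc k"
  shows "treewidth H \<le> k"
proof -
  have "graph_tree T" using assms(1) by (simp add: tree_decomposition_iff)
  then have T: "finite (pverts T)" "pverts T \<noteq> {}"
    by (auto simp: graph_tree_iff dest: pair_graph_finite connected_set_nonempty)
  have "Max ((\<lambda>x. card (B x)) ` pverts T) \<le> Suc k"
    using T assms(2) by (subst Max_le_iff) auto
  then have "decomposition_width T B \<le> k" by (simp add: decomposition_width_def)
  moreover have "treewidth H \<le> decomposition_width T B"
    unfolding treewidth_def by (rule Least_le) (use assms(1) in blast)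
  ultimately show ?thesis by simp
qed

context decomposed_graph
begin

lemma set_bag_width_le:
  assumes "covered_by_bags k S"
  shows "set_bag_width T W S \<le> k"
proof -
  obtain M where M: "M \<subseteq> pverts T" "card M \<le> k" "S \<subseteq> \<Union>(W ` M)"
    using assms unfolding covered_by_bags_def by blast
  have "set_bag_width T W S \<le> card M"
    unfolding set_bag_width_def by (rule Least_le) (use M(1,3) in blast)
  then show ?thesis using M(2) by simp
qed

definition extendable ::
  "nat \<Rightarrow> 'a set set \<Rightarrow> nat pair_pre_digraph \<Rightarrow> (nat \<Rightarrow> 'a set set) \<Rightarrow> 'a set \<Rightarrow> bool" where
  "extendable s \<P> T' B D \<longleftrightarrow>
     card (attached (parcs G) \<P> D) \<le> s \<and> (\<exists>x\<in>pverts T'. attached (parcs G) \<P> D \<subseteq> B x) \<and>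
     (\<exists>R. rooted_model (parcs G) (pverts G) D (attached (parcs G) \<P> D) R)"

definition partial_partition ::
  "nat \<Rightarrow> nat \<Rightarrow> 'a set set \<Rightarrow> nat pair_pre_digraph \<Rightarrow> (nat \<Rightarrow> 'a set set) \<Rightarrow> bool" where
  "partial_partition s t \<P> T' B \<longleftrightarrow>
     partition_on (\<Union>\<P>) \<P> \<and> (\<forall>P\<in>\<P>. P \<subseteq> pverts G \<and> covered_by_bags (t - 1) P) \<and>
     tree_decomposition (contact_graph (parcs G) \<P>) T' B \<and> (\<forall>x\<in>pverts T'. card (B x) \<le> Suc s) \<and>
     (\<forall>D\<in>components (parcs G) (pverts G - \<Union>\<P>). extendable s \<P> T' B D)"

lemma partial_partition_empty: "partial_partition s t {} \<lparr>pverts = {0}, parcs = {}\<rparr> (\<lambda>_. {})"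
  unfolding partial_partition_def extendable_def tree_decomposition_iff
  by (simp add: graph_tree_singleton partition_on_empty attached_def rooted_model_def [abs_def])

lemma extendable_other_component:
  assumes "extendable s \<P> T' B D" "l \<notin> pverts T'" "\<not> touches (parcs G) D Y"
  shows "extendable s (insert Y \<P>) (add_leaf T' x l) (B(l := L)) D"
proof -
  have "attached (parcs G) (insert Y \<P>) D = attached (parcs G) \<P> D"
    using assms(3) by (simp add: attached_insert)
  then show ?thesis using assms(1,2) unfolding extendable_def by auto
qed

lemma extendable_subcomponent:
  assumes "finite N" "card (attached (parcs G) N D) < s"
    and "attached (parcs G) \<P> D = attached (parcs G) N D"
    and "rooted_model (parcs G) (pverts G) D (insert Y (attached (parcs G) N D)) R"
  shows "extendable s (insert Y \<P>) (add_leaf T' x l) (B(l := insert Y N)) D"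
proof -
  let ?A = "attached (parcs G) (insert Y \<P>) D"
  have sub: "?A \<subseteq> insert Y (attached (parcs G) N D)" by (auto simp: attached_insert assms(3))
  have finite: "finite (attached (parcs G) N D)"
    using assms(1) attached_subset by (meson finite_subset)
  then have "card ?A \<le> card (insert Y (attached (parcs G) N D))" using sub by (intro card_mono) simp
  also have "\<dots> \<le> s" using assms(2) finite by (simp add: card_insert_if)
  finally have "card ?A \<le> s" .
  moreover have "?A \<subseteq> insert Y N" using sub attached_subset by blast
  moreover have "rooted_model (parcs G) (pverts G) D ?A R"
    using assms(4) sub subset_refl by (rule rooted_model_mono)
  ultimately show ?thesis unfolding extendable_def by auto
qed

lemma extendable_insert:
  assumes ext: "\<forall>D\<in>components (parcs G) (pverts G - \<Union>\<P>). extendable s \<P> T' B D"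
    and C: "C \<in> components (parcs G) (pverts G - \<Union>\<P>)"
    and N: "N = attached (parcs G) \<P> C" "finite N"
    and Y: "valid_part (parcs G) (pverts G) s N C Y" and l: "l \<notin> pverts T'"
    and D: "D \<in> components (parcs G) (pverts G - \<Union>(insert Y \<P>))"
  shows "extendable s (insert Y \<P>) (add_leaf T' x l) (B(l := insert Y N)) D"
proof -
  have "Y \<subseteq> C" using Y by (simp add: valid_part_def)
  have "pverts G - \<Union>(insert Y \<P>) = (pverts G - \<Union>\<P>) - Y" by blast
  then consider (old) "D \<in> components (parcs G) (pverts G - \<Union>\<P>)" "D \<noteq> C"
    | (new) "D \<in> components (parcs G) (C - Y)"
    using components_Diff_subset[OF sym_arcs C \<open>Y \<subseteq> C\<close>] D by auto
  then show ?thesis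
  proof cases
    case old
    have "\<not> touches (parcs G) D C" using old C by (intro components_not_touches)
    then have "\<not> touches (parcs G) D Y" using touches_mono \<open>Y \<subseteq> C\<close> by blast
    then show ?thesis using ext old(1) l by (intro extendable_other_component) blast+
  next
    case new
    have "D \<subseteq> C" using components_subset[OF new] by blast
    then have "attached (parcs G) \<P> D = attached (parcs G) N D"
      by (simp add: N(1) attached_attached)
    then show ?thesis
      using Y new extendable_subcomponent[OF N(2)] unfolding valid_part_def by blast
  qed
qed

lemma partial_partition_insert:
  assumes inv: "partial_partition s t \<P> T' B" and C: "C \<in> components (parcs G) (pverts G - \<Union>\<P>)"
    and N: "N = attached (parcs G) \<P> C" "finite N" "card N \<le> s"
    and x: "x \<in> pverts T'" "N \<subseteq> B x" and l: "l \<notin> pverts T'"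
    and Y: "valid_part (parcs G) (pverts G) s N C Y" "covered_by_bags (t - 1) Y"
  shows "partial_partition s t (insert Y \<P>) (add_leaf T' x l) (B(l := insert Y N))"
    (is "partial_partition s t _ ?T ?B")
  unfolding partial_partition_def
proof (intro conjI)
  have Y_sub: "Y \<noteq> {}" "Y \<subseteq> C" "Y \<subseteq> pverts G - \<Union>\<P>"
    using Y(1) components_subset[OF C] by (auto simp: valid_part_def)
  show "partition_on (\<Union>(insert Y \<P>)) (insert Y \<P>)"
    using inv Y_sub
    unfolding partial_partition_def partition_on_def pairwise_insert disjnt_def by blast
  show "\<forall>P\<in>insert Y \<P>. P \<subseteq> pverts G \<and> covered_by_bags (t - 1) P"
    using inv Y(2) Y_sub(3) unfolding partial_partition_def by blast
  have "tree_decomposition (contact_graph (parcs G) \<P>) T' B"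
    using inv by (simp add: partial_partition_def)
  moreover have "attached (parcs G) \<P> Y \<subseteq> N" unfolding N(1) by (rule attached_mono[OF Y_sub(2)])
  moreover have "Y \<notin> \<P>" using Y_sub(1,3) by blast
  ultimately show "tree_decomposition (contact_graph (parcs G) (insert Y \<P>)) ?T ?B"
    using sym_arcs x l by (intro tree_decomposition_contact_graph_insert)
  show "\<forall>y\<in>pverts ?T. card (?B y) \<le> Suc s"
    using inv N(2,3) by (simp add: partial_partition_def card_insert_if)
  show "\<forall>D\<in>components (parcs G) (pverts G - \<Union>(insert Y \<P>)).
      extendable s (insert Y \<P>) ?T ?B D"
    using inv extendable_insert[OF _ C N(1,2) Y(1) l] unfolding partial_partition_def by blast
qed

lemma partial_partition_step:
  assumes free: "J_minor_free s t G" "2 \<le> t" and inv: "partial_partition s t \<P> T' B"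
    and C: "C \<in> components (parcs G) (pverts G - \<Union>\<P>)"
  obtains Y T'' B' where "Y \<noteq> {}" "Y \<subseteq> C" "partial_partition s t (insert Y \<P>) T'' B'"
proof -
  define N where "N = attached (parcs G) \<P> C"
  have "extendable s \<P> T' B C" using inv C by (simp add: partial_partition_def)
  then obtain x R where "card N \<le> s" and x: "x \<in> pverts T'" "N \<subseteq> B x"
    and R: "rooted_model (parcs G) (pverts G) C N R"
    unfolding extendable_def N_def by blast
  have "\<Union>\<P> \<subseteq> pverts G" using inv by (auto simp: partial_partition_def)
  then have "finite \<P>" using finite_verts by (intro finite_UnionD) (rule finite_subset)
  then have "finite N" unfolding N_def using attached_subset by (rule rev_finite_subset)
  have "C \<subseteq> pverts G" "\<Union>N \<inter> C = {}"
    using components_subset[OF C] attached_subset unfolding N_def by blast+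
  moreover have "colourful (parcs G) N C" by (simp add: colourful_def N_def attached_attached)
  ultimately obtain Y where Y: "valid_part (parcs G) (pverts G) s N C Y" "covered_by_bags (t - 1) Y"
    using obtain_new_part[OF free components_connected[OF C] _ \<open>finite N\<close> \<open>card N \<le> s\<close> _ _ R]
    by blast
  have "finite (pverts T')"
    using inv
    by (simp add: partial_partition_def tree_decomposition_iff graph_tree_iff pair_graph_finite)
  then obtain l where "l \<notin> pverts T'" using ex_new_if_finite[OF infinite_UNIV_nat] by blast
  then have "partial_partition s t (insert Y \<P>) (add_leaf T' x l) (B(l := insert Y N))"
    using inv C N_def \<open>finite N\<close> \<open>card N \<le> s\<close> x Y by (intro partial_partition_insert)
  moreover have "Y \<noteq> {}" "Y \<subseteq> C" using Y(1) by (simp_all add: valid_part_def)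
  ultimately show thesis using that by blast
qed

lemma partial_partition_completion:
  assumes "J_minor_free s t G" "2 \<le> t" "partial_partition s t \<P> T' B"
  shows "\<exists>\<P> T' B. partial_partition s t \<P> T' B \<and> \<Union>\<P> = pverts G"
  using assms(3)
proof (induction "card (pverts G - \<Union>\<P>)" arbitrary: \<P> T' B rule: less_induct)
  case less
  show ?case
  proof (cases "pverts G \<subseteq> \<Union>\<P>")
    case True
    then have "\<Union>\<P> = pverts G" using less.prems unfolding partial_partition_def by blast
    then show ?thesis using less.prems by blast
  next
    case False
    then obtain C where C: "C \<in> components (parcs G) (pverts G - \<Union>\<P>)"
      using Union_components[OF sym_arcs, of "pverts G - \<Union>\<P>"] by blast
    obtain Y T'' B' where Y: "Y \<noteq> {}" "Y \<subseteq> C" "partial_partition s t (insert Y \<P>) T'' B'"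
      using partial_partition_step[OF assms(1,2) less.prems C] by blast
    have "pverts G - \<Union>(insert Y \<P>) \<subset> pverts G - \<Union>\<P>"
      using Y(1,2) components_subset[OF C] by blast
    then have "card (pverts G - \<Union>(insert Y \<P>)) < card (pverts G - \<Union>\<P>)"
      using finite_verts by (intro psubset_card_mono) simp
    then show ?thesis using Y(3) by (rule less.hyps)
  qed
qed

end

theorem theorem12:
  fixes s t :: nat
    and G :: "'a pair_pre_digraph"
    and T :: "'b pair_pre_digraph"
    and W :: "'b \<Rightarrow> 'a set"
  assumes "2 \<le> s" and "2 \<le> t"
    and "pair_graph G"
    and "J_minor_free s t G"
    and "tree_decomposition G T W"
  shows "\<exists>H. graph_partition G H \<and> partition_bag_width T W H \<le> t - 1 \<and> treewidth H \<le> s"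
proof -
  have tree: "graph_tree T" using assms(5) by (simp add: tree_decomposition_iff)
  then obtain r where "r \<in> pverts T" using connected_set_nonempty unfolding graph_tree_iff by blast
  with tree assms(3,5) interpret decomposed_graph T r G W
    by (intro decomposed_graph.intro rooted_tree.intro decomposed_graph_axioms.intro)
  obtain \<P> T' B where parts: "partial_partition s t \<P> T' B" "\<Union>\<P> = pverts G"
    using partial_partition_completion[OF assms(4,2) partial_partition_empty] by blast
  let ?H = "contact_graph (parcs G) \<P>"
  have partition: "graph_partition G ?H"
    using assms(3) parts
    unfolding partial_partition_def by (intro graph_partition_contact_graph) simp_all
  moreover have "partition_bag_width T W ?H \<le> t - 1"
  proof (rule partition_bag_width_le)
    show "finite (pverts ?H)"
      using partition pair_graph_finite[of ?H] by (simp add: graph_partition_def)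
    show "set_bag_width T W P \<le> t - 1" if "P \<in> pverts ?H" for P
      using that parts(1) by (intro set_bag_width_le) (simp add: partial_partition_def)
  qed
  moreover have "treewidth ?H \<le> s"
    using parts(1) unfolding partial_partition_def by (blast intro: treewidth_le)
  ultimately show ?thesis by blast
qed

end
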